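(* Let $\rho,\sigma$ be gauges and let $(x_n)_n:{}^{\sigma}\widetilde{\mathbb N}\to{}^{\rho}\widetilde{\mathbb R}$ be a non-decreasing hypersequence. Then the hyperlimit of $(x_n)_n$ exists if and only if the sharp supremum $\sup\{x_n\mid n\in{}^{\sigma}\widetilde{\mathbb N}\}$ exists, and in that case they are equal. In particular, if $\{x_n\mid n\in{}^{\sigma}\widetilde{\mathbb N}\}$ is complete from above for all the upper bounds, then the hyperlimit of $(x_n)_n$ exists if and only if there exists $U\in{}^{\rho}\widetilde{\mathbb R}$ such that $x_n\le U$ for all $n\in{}^{\sigma}\widetilde{\mathbb N}$.
   Context: Let $I=(0,1]$. A gauge is a net $\rho=(\rho_\varepsilon)_{\varepsilon\in I}\in(0,1]^I$ with $\rho_\varepsilon\to0$ as $\varepsilon\to0^+$. "$\forall^0\varepsilon:\ P(\varepsilon)$" means: there is $\varepsilon_0\in I$ such that $P(\varepsilon)$ holds for all $\varepsilon\in(0,\varepsilon_0]$. $\mathbb R_\rho$ is the ring of $\rho$-moderate nets: $(x_\varepsilon)\in\mathbb R^I$ with $\exists N\in\mathbb N\,\forall^0\varepsilon:\ |x_\varepsilon|\le\rho_\varepsilon^{-N}$. Write $(x_\varepsilon)\sim_\rho(y_\varepsilon)$ if $\forall n\in\mathbb N\,\forall^0\varepsilon:\ |x_\varepsilon-y_\varepsilon|\le\rho_\varepsilon^n$; a net is $\rho$-negligible if it is $\sim_\rho 0$. ${}^{\rho}\widetilde{\mathbb R}:=\mathbb R_\rho/\sim_\rho$ (a ring with pointwise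 operations); classes are denoted $[x_\varepsilon]$. Order: $[x_\varepsilon]\le[y_\varepsilon]$ iff there is a $\rho$-negligible $(z_\varepsilon)$ with $\forall^0\varepsilon:\ x_\varepsilon\le y_\varepsilon+z_\varepsilon$; $x<y$ means $x\le y$ and $y-x$ is invertible. $|[x_\varepsilon]|:=[|x_\varepsilon|]$, and $\mathrm d\rho:=[\rho_\varepsilon]$. The sharp topology on ${}^{\rho}\widetilde{\mathbb R}$ has as base the balls $B_r(x)=\{y\mid |y-x|<r\}$, $r>0$. Given a gauge $\sigma$, ${}^{\sigma}\widetilde{\mathbb N}:=\{[n_\varepsilon]\in{}^{\sigma}\widetilde{\mathbb R}\mid n_\varepsilon\in\mathbb N\ \forall\varepsilon\}$, ordered by the order $\le$ of ${}^{\sigma}\widetilde{\mathbb R}$. A hypersequence is a map $x:{}^{\sigma}\widetilde{\mathbb N}\to{}^{\rho}\widetilde{\mathbb R}$, $x_n:=x(n)$. An element $l\in{}^{\rho}\widetilde{\mathbb R}$ is the hyperlimit of $(x_n)_n$ if $\forall q\in\mathbb N\,\exists M\in{}^{\sigma}\widetilde{\mathbb N}\,\forall n\in{}^{\sigma}\widetilde{\mathbb N},\ n\ge M:\ |x_n-l|<\mathrm d\rho^q$. The hypersequence is non-decreasing if $n\ge m$ implies $x_n\ge x_m$ for all $n,m\in{}^{\sigma}\widetilde{\mathbb N}$. Sharp supremum: for $S\subseteq{}^{\rho}\widetilde{\mathbb R}$, $s^*=\sup(S)$ means that $s^*\in{}^{\rho}\widetilde{\mathbb R}$, $s\le s^*$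 for all $s\in S$, and $s^*$ belongs to the closure of $S$ in the sharp topology (given the first properties, the latter is equivalent to $\forall q\in\mathbb N\,\exists\bar s\in S:\ s^*-\mathrm d\rho^q\le\bar s$). It is not the order-theoretic least upper bound. Completeness from above. For $S\subseteq{}^{\rho}\widetilde{\mathbb R}$, $u\ge S$ means that $u\in{}^{\rho}\widetilde{\mathbb R}$ is an upper bound of $S$. Fix the following choices: for each $u\ge S$ a representative $(u_\varepsilon)_{\varepsilon\in I}$ of $u$; and for each net $(u_\varepsilon)\in(\mathbb R\cup\{+\infty\})^I$ and each $s\in S$ a representative $(s_\varepsilon(u))_{\varepsilon\in I}$ of $s$ such that, if $(u_\varepsilon)\in\mathbb R_\rho$ and $s\le[u_\varepsilon]$, then $s_\varepsilon(u)\le u_\varepsilon$ for all $\varepsilon\in I$ (in all other cases it is any representative of $s$). For $u\ge S$, $s_\varepsilon(u)$ refers to the chosen representative $(u_\varepsilon)$ of $u$. Define for all $\varepsilon\in I$: $\lambda_\varepsilon(S):=\inf\{\sup\{s_\varepsilon(u)\mid s\in S\}\mid u\ge S\}$, where $u$ ranges over all the upper bounds of $S$ (with $\inf\emptyset=+\infty$, $\sup\emptyset=-\infty$). $S$ is complete from above (with respect to these choices) if: (1) $\forall s\in S\,\exists[s_\varepsilon]=s\,\forall^0\varepsilon:\ s_\varepsilon\le\lambda_\varepsilon(S)$; (2) for every family $(s^e)_{e\in I}$ of elements of $S$ such that $\exists[u_\varepsilon]\in{}^{\rho}\widetilde{\mathbb R}\,\forall e\in I\,\forall^0\varepsilon:\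 s^e_\varepsilon(\lambda)\le u_\varepsilon$, there exists $[\bar s_\varepsilon]\in\overline S$ with $\forall^0\varepsilon:\ s^\varepsilon_\varepsilon(\lambda)\le\bar s_\varepsilon$. Here $\overline S$ is the closure of $S$ in the sharp topology and $(s^e_\varepsilon(\lambda))_\varepsilon$ is the chosen representative of $s^e$ associated with the net $(\lambda_\varepsilon(S))_\varepsilon$. "Complete from above for all the upper bounds" is understood as this notion, the infimum defining $\lambda_\varepsilon(S)$ being taken over all the upper bounds of $S$. *)

theory Defs
  imports "HOL-Analysis.Analysis" "HOL-Algebra.Ring"
begin

typedef idx = "{0<..1::real}"
  morphisms of_idx to_idx
  by (rule exI[of _ 1]) simp

instantiation idx :: linorder
begin

definition less_eq_idx :: "idx \<Rightarrow> idx \<Rightarrow> bool"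
  where "less_eq_idx a b \<longleftrightarrow> of_idx a \<le> of_idx b"

definition less_idx :: "idx \<Rightarrow> idx \<Rightarrow> bool"
  where "less_idx a b \<longleftrightarrow> of_idx a < of_idx b"

instance
  by standard (auto simp: less_eq_idx_def less_idx_def of_idx_inject)

end

text \<open>
  The type \<open>idx\<close> has no least element, so its filter \<open>at_bot\<close> is the limit
  \<open>\<epsilon> \<rightarrow> 0\<^sup>+\<close>, and \<open>\<forall>\<^sub>F \<epsilon> in at_bot. P \<epsilon>\<close> means: there is \<open>\<epsilon>\<^sub>0 \<in> I\<close> such that \<open>P\<close> holds on
  \<open>(0,\<epsilon>\<^sub>0]\<close>.
\<close>

lemma eventually_at_bot_idx:
  "(\<forall>\<^sub>F \<epsilon> in at_bot. P (\<epsilon> :: idx)) \<longleftrightarrow>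
     (\<exists>e0\<in>{0<..1::real}. \<forall>e\<in>{0<..e0}. P (to_idx e))"
proof
  assume "\<forall>\<^sub>F \<epsilon> in at_bot. P (\<epsilon> :: idx)"
  then obtain k where k: "\<And>n. n \<le> k \<Longrightarrow> P n"
    by (auto simp: eventually_at_bot_linorder)
  show "\<exists>e0\<in>{0<..1::real}. \<forall>e\<in>{0<..e0}. P (to_idx e)"
    using of_idx[of k]
    by (intro bexI[of _ "of_idx k"] ballI k) (auto simp: less_eq_idx_def to_idx_inverse)
next
  assume "\<exists>e0\<in>{0<..1::real}. \<forall>e\<in>{0<..e0}. P (to_idx e)"
  then obtain e0 where e0: "e0 \<in> {0<..1::real}" and P: "\<And>e. e \<in> {0<..e0} \<Longrightarrow> P (to_idx e)"
    by blast
  have "P n" if "n \<le> to_idx e0" for n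
    using P[of "of_idx n"] of_idx[of n] that e0
    by (simp add: less_eq_idx_def to_idx_inverse of_idx_inverse)
  then show "\<forall>\<^sub>F \<epsilon> in at_bot. P (\<epsilon> :: idx)"
    by (auto simp: eventually_at_bot_linorder)
qed

lemma at_bot_idx_neq_bot: "(at_bot :: idx filter) \<noteq> bot"
  by (simp add: trivial_limit_at_bot_linorder)

definition gauge_net :: "(idx \<Rightarrow> real) \<Rightarrow> bool"
  where "gauge_net \<rho> \<longleftrightarrow> (\<forall>\<epsilon>. \<rho> \<epsilon> \<in> {0<..1}) \<and> (\<rho> \<longlongrightarrow> 0) at_bot"

definition moderate :: "(idx \<Rightarrow> real) \<Rightarrow> (idx \<Rightarrow> real) set"
  where "moderate \<rho> = {x. \<exists>N::nat. \<forall>\<^sub>F \<epsilon> in at_bot. \<bar>x \<epsilon>\<bar> \<le> inverse (\<rho> \<epsilon> ^ N)}"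

definition net_sim :: "(idx \<Rightarrow> real) \<Rightarrow> (idx \<Rightarrow> real) \<Rightarrow> (idx \<Rightarrow> real) \<Rightarrow> bool"
  where "net_sim \<rho> x y \<longleftrightarrow> (\<forall>n::nat. \<forall>\<^sub>F \<epsilon> in at_bot. \<bar>x \<epsilon> - y \<epsilon>\<bar> \<le> \<rho> \<epsilon> ^ n)"

definition negligible_net :: "(idx \<Rightarrow> real) \<Rightarrow> (idx \<Rightarrow> real) \<Rightarrow> bool"
  where "negligible_net \<rho> z \<longleftrightarrow> net_sim \<rho> z (\<lambda>_. 0)"

definition net_rel :: "(idx \<Rightarrow> real) \<Rightarrow> ((idx \<Rightarrow> real) \<times> (idx \<Rightarrow> real)) set"
  where "net_rel \<rho> = {(x, y). x \<in> moderate \<rho> \<and> y \<in> moderate \<rho> \<and> net_sim \<rho> x y}"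

definition gcls :: "(idx \<Rightarrow> real) \<Rightarrow> (idx \<Rightarrow> real) \<Rightarrow> (idx \<Rightarrow> real) set"
  where "gcls \<rho> x = net_rel \<rho> `` {x}"

definition gring :: "(idx \<Rightarrow> real) \<Rightarrow> (idx \<Rightarrow> real) set ring"
  where "gring \<rho> =
    \<lparr>carrier = moderate \<rho> // net_rel \<rho>,
     mult = (\<lambda>X Y. \<Union>x\<in>X. \<Union>y\<in>Y. gcls \<rho> (\<lambda>\<epsilon>. x \<epsilon> * y \<epsilon>)),
     one = gcls \<rho> (\<lambda>_. 1),
     zero = gcls \<rho> (\<lambda>_. 0),
     add = (\<lambda>X Y. \<Union>x\<in>X. \<Union>y\<in>Y. gcls \<rho> (\<lambda>\<epsilon>. x \<epsilon> + y \<epsilon>))\<rparr>"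

definition gabs :: "(idx \<Rightarrow> real) \<Rightarrow> (idx \<Rightarrow> real) set \<Rightarrow> (idx \<Rightarrow> real) set"
  where "gabs \<rho> X = (\<Union>x\<in>X. gcls \<rho> (\<lambda>\<epsilon>. \<bar>x \<epsilon>\<bar>))"

definition gle :: "(idx \<Rightarrow> real) \<Rightarrow> (idx \<Rightarrow> real) set \<Rightarrow> (idx \<Rightarrow> real) set \<Rightarrow> bool"
  where "gle \<rho> X Y \<longleftrightarrow>
    (\<exists>x\<in>X. \<exists>y\<in>Y. \<exists>z. negligible_net \<rho> z \<and> (\<forall>\<^sub>F \<epsilon> in at_bot. x \<epsilon> \<le> y \<epsilon> + z \<epsilon>))"

definition glt :: "(idx \<Rightarrow> real) \<Rightarrow> (idx \<Rightarrow> real) set \<Rightarrow> (idx \<Rightarrow> real) set \<Rightarrow> bool"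
  where "glt \<rho> X Y \<longleftrightarrow> gle \<rho> X Y \<and> Y \<ominus>\<^bsub>gring \<rho>\<^esub> X \<in> Units (gring \<rho>)"

context
  fixes \<rho> :: "idx \<Rightarrow> real"
  assumes \<rho>: "gauge_net \<rho>"
begin

lemma gauge_bounds: "0 < \<rho> \<epsilon>" "\<rho> \<epsilon> \<le> 1" "0 \<le> \<rho> \<epsilon>"
  using \<rho> by (auto simp: gauge_net_def less_imp_le)

lemma gauge_le_half: "\<forall>\<^sub>F \<epsilon> in at_bot. \<rho> \<epsilon> \<le> 1 / 2"
proof -
  have "(\<rho> \<longlongrightarrow> 0) at_bot" using \<rho> by (simp add: gauge_net_def)
  then have "\<forall>\<^sub>F \<epsilon> in at_bot. \<rho> \<epsilon> < 1 / 2" by (rule order_tendstoD) simp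
  then show ?thesis by (rule eventually_mono) simp
qed

lemma moderate_const: "(\<lambda>_. c) \<in> moderate \<rho>"
proof -
  obtain N :: nat where N: "\<bar>c\<bar> \<le> 2 ^ N"
    using real_arch_pow[of 2 "\<bar>c\<bar>"] by (auto intro: less_imp_le)
  have "\<forall>\<^sub>F \<epsilon> in at_bot. \<bar>c\<bar> \<le> inverse (\<rho> \<epsilon> ^ N)"
    using gauge_le_half
  proof (rule eventually_mono)
    fix \<epsilon> assume "\<rho> \<epsilon> \<le> 1 / 2"
    then have "\<rho> \<epsilon> ^ N \<le> (1 / 2) ^ N" by (intro power_mono gauge_bounds)
    then have "inverse ((1 / 2) ^ N) \<le> inverse (\<rho> \<epsilon> ^ N)"
      by (intro le_imp_inverse_le zero_less_power gauge_bounds)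
    with N show "\<bar>c\<bar> \<le> inverse (\<rho> \<epsilon> ^ N)" by (simp add: power_one_over)
  qed
  then show ?thesis by (auto simp: moderate_def)
qed

lemma moderate_mult:
  assumes "x \<in> moderate \<rho>" "y \<in> moderate \<rho>"
  shows "(\<lambda>\<epsilon>. x \<epsilon> * y \<epsilon>) \<in> moderate \<rho>"
proof -
  obtain N M where N: "\<forall>\<^sub>F \<epsilon> in at_bot. \<bar>x \<epsilon>\<bar> \<le> inverse (\<rho> \<epsilon> ^ N)"
    and M: "\<forall>\<^sub>F \<epsilon> in at_bot. \<bar>y \<epsilon>\<bar> \<le> inverse (\<rho> \<epsilon> ^ M)"
    using assms by (auto simp: moderate_def)
  have "\<forall>\<^sub>F \<epsilon> in at_bot. \<bar>x \<epsilon> * y \<epsilon>\<bar> \<le> inverse (\<rho> \<epsilon> ^ (N + M))"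
    using N M
  proof eventually_elim
    case (elim \<epsilon>)
    then have "\<bar>x \<epsilon>\<bar> * \<bar>y \<epsilon>\<bar> \<le> inverse (\<rho> \<epsilon> ^ N) * inverse (\<rho> \<epsilon> ^ M)"
      using gauge_bounds[of \<epsilon>] by (intro mult_mono) auto
    then show ?case by (simp add: abs_mult power_add)
  qed
  then show ?thesis by (auto simp: moderate_def)
qed

lemma moderate_bound:
  assumes "x \<in> moderate \<rho>" "\<forall>\<^sub>F \<epsilon> in at_bot. \<bar>y \<epsilon>\<bar> \<le> \<bar>x \<epsilon>\<bar>"
  shows "y \<in> moderate \<rho>"
proof -
  obtain N where N: "\<forall>\<^sub>F \<epsilon> in at_bot. \<bar>x \<epsilon>\<bar> \<le> inverse (\<rho> \<epsilon> ^ N)"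
    using assms by (auto simp: moderate_def)
  have "\<forall>\<^sub>F \<epsilon> in at_bot. \<bar>y \<epsilon>\<bar> \<le> inverse (\<rho> \<epsilon> ^ N)"
    using N assms(2) by eventually_elim simp
  then show ?thesis by (auto simp: moderate_def)
qed

lemma moderate_abs: "x \<in> moderate \<rho> \<Longrightarrow> (\<lambda>\<epsilon>. \<bar>x \<epsilon>\<bar>) \<in> moderate \<rho>"
  by (erule moderate_bound) simp

lemma moderate_add:
  assumes "x \<in> moderate \<rho>" "y \<in> moderate \<rho>"
  shows "(\<lambda>\<epsilon>. x \<epsilon> + y \<epsilon>) \<in> moderate \<rho>"
proof -
  obtain N M where N: "\<forall>\<^sub>F \<epsilon> in at_bot. \<bar>x \<epsilon>\<bar> \<le> inverse (\<rho> \<epsilon> ^ N)"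
    and M: "\<forall>\<^sub>F \<epsilon> in at_bot. \<bar>y \<epsilon>\<bar> \<le> inverse (\<rho> \<epsilon> ^ M)"
    using assms by (auto simp: moderate_def)
  have *: "(\<lambda>\<epsilon>. 2 * inverse (\<rho> \<epsilon> ^ (N + M))) \<in> moderate \<rho>"
    by (intro moderate_mult moderate_const)
      (auto simp: moderate_def gauge_bounds intro!: exI[of _ "N + M"] always_eventually)
  show ?thesis
  proof (rule moderate_bound[OF *])
    show "\<forall>\<^sub>F \<epsilon> in at_bot. \<bar>x \<epsilon> + y \<epsilon>\<bar> \<le> \<bar>2 * inverse (\<rho> \<epsilon> ^ (N + M))\<bar>"
      using N M
    proof eventually_elim
      case (elim \<epsilon>)
      have "\<rho> \<epsilon> ^ (N + M) \<le> \<rho> \<epsilon> ^ N" "\<rho> \<epsilon> ^ (N + M) \<le> \<rho> \<epsilon> ^ M"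
        by (intro power_decreasing; simp add: gauge_bounds)+
      then have "inverse (\<rho> \<epsilon> ^ N) \<le> inverse (\<rho> \<epsilon> ^ (N + M))"
        "inverse (\<rho> \<epsilon> ^ M) \<le> inverse (\<rho> \<epsilon> ^ (N + M))"
        by (intro le_imp_inverse_le zero_less_power gauge_bounds; simp)+
      with elim show ?case by linarith
    qed
  qed
qed

lemma moderate_uminus: "x \<in> moderate \<rho> \<Longrightarrow> (\<lambda>\<epsilon>. - x \<epsilon>) \<in> moderate \<rho>"
  by (erule moderate_bound) simp

lemma moderate_gauge: "\<rho> \<in> moderate \<rho>"
  by (rule moderate_bound[OF moderate_const[of 1]]) (simp add: gauge_bounds)

lemma net_sim_refl: "net_sim \<rho> x x"
  by (simp add: net_sim_def gauge_bounds)

lemma net_sim_sym: "net_sim \<rho> x y \<Longrightarrow> net_sim \<rho> y x"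
  by (simp add: net_sim_def abs_minus_commute)

lemma net_sim_absorb:
  assumes "c \<in> moderate \<rho>"
    and "\<And>n. \<forall>\<^sub>F \<epsilon> in at_bot. \<bar>x \<epsilon> - y \<epsilon>\<bar> \<le> \<bar>c \<epsilon>\<bar> * \<rho> \<epsilon> ^ n"
  shows "net_sim \<rho> x y"
  unfolding net_sim_def
proof
  fix n
  obtain N where N: "\<forall>\<^sub>F \<epsilon> in at_bot. \<bar>c \<epsilon>\<bar> \<le> inverse (\<rho> \<epsilon> ^ N)"
    using assms by (auto simp: moderate_def)
  show "\<forall>\<^sub>F \<epsilon> in at_bot. \<bar>x \<epsilon> - y \<epsilon>\<bar> \<le> \<rho> \<epsilon> ^ n"
    using N assms(2)[of "n + N"]
  proof eventually_elim
    case (elim \<epsilon>)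
    have "\<bar>c \<epsilon>\<bar> * \<rho> \<epsilon> ^ (n + N) \<le> inverse (\<rho> \<epsilon> ^ N) * \<rho> \<epsilon> ^ (n + N)"
      by (intro mult_right_mono elim) (simp add: gauge_bounds)
    also have "\<dots> = \<rho> \<epsilon> ^ n"
      using gauge_bounds(1)[of \<epsilon>] by (simp add: power_add field_simps)
    finally show ?case using elim by linarith
  qed
qed

lemma net_sim_add:
  assumes "net_sim \<rho> x x'" "net_sim \<rho> y y'"
  shows "net_sim \<rho> (\<lambda>\<epsilon>. x \<epsilon> + y \<epsilon>) (\<lambda>\<epsilon>. x' \<epsilon> + y' \<epsilon>)"
proof (rule net_sim_absorb[OF moderate_const[of 2]])
  fix n
  have "\<forall>\<^sub>F \<epsilon> in at_bot. \<bar>x \<epsilon> - x' \<epsilon>\<bar> \<le> \<rho> \<epsilon> ^ n" "\<forall>\<^sub>F \<epsilon> in at_bot. \<bar>y \<epsilon> - y' \<epsilon>\<bar> \<le> \<rho> \<epsilon> ^ n"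
    using assms by (auto simp: net_sim_def)
  then show "\<forall>\<^sub>F \<epsilon> in at_bot. \<bar>x \<epsilon> + y \<epsilon> - (x' \<epsilon> + y' \<epsilon>)\<bar> \<le> \<bar>2\<bar> * \<rho> \<epsilon> ^ n"
    by eventually_elim simp
qed

lemma net_sim_trans:
  assumes "net_sim \<rho> x y" "net_sim \<rho> y z"
  shows "net_sim \<rho> x z"
proof (rule net_sim_absorb[OF moderate_const[of 2]])
  fix n
  have "\<forall>\<^sub>F \<epsilon> in at_bot. \<bar>x \<epsilon> - y \<epsilon>\<bar> \<le> \<rho> \<epsilon> ^ n" "\<forall>\<^sub>F \<epsilon> in at_bot. \<bar>y \<epsilon> - z \<epsilon>\<bar> \<le> \<rho> \<epsilon> ^ n"
    using assms by (auto simp: net_sim_def)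
  then show "\<forall>\<^sub>F \<epsilon> in at_bot. \<bar>x \<epsilon> - z \<epsilon>\<bar> \<le> \<bar>2\<bar> * \<rho> \<epsilon> ^ n"
    by eventually_elim simp
qed

lemma net_sim_abs: "net_sim \<rho> x y \<Longrightarrow> net_sim \<rho> (\<lambda>\<epsilon>. \<bar>x \<epsilon>\<bar>) (\<lambda>\<epsilon>. \<bar>y \<epsilon>\<bar>)"
  unfolding net_sim_def
proof (rule allI)
  fix n assume "\<forall>n. \<forall>\<^sub>F \<epsilon> in at_bot. \<bar>x \<epsilon> - y \<epsilon>\<bar> \<le> \<rho> \<epsilon> ^ n"
  then have "\<forall>\<^sub>F \<epsilon> in at_bot. \<bar>x \<epsilon> - y \<epsilon>\<bar> \<le> \<rho> \<epsilon> ^ n" by blast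
  then show "\<forall>\<^sub>F \<epsilon> in at_bot. \<bar>\<bar>x \<epsilon>\<bar> - \<bar>y \<epsilon>\<bar>\<bar> \<le> \<rho> \<epsilon> ^ n"
    by eventually_elim linarith
qed

lemma net_sim_mult:
  assumes "net_sim \<rho> x x'" "net_sim \<rho> y y'" "x \<in> moderate \<rho>" "y' \<in> moderate \<rho>"
  shows "net_sim \<rho> (\<lambda>\<epsilon>. x \<epsilon> * y \<epsilon>) (\<lambda>\<epsilon>. x' \<epsilon> * y' \<epsilon>)"
proof (rule net_sim_absorb[OF moderate_add[OF moderate_abs moderate_abs, OF assms(3,4)]])
  fix n
  have "\<forall>\<^sub>F \<epsilon> in at_bot. \<bar>x \<epsilon> - x' \<epsilon>\<bar> \<le> \<rho> \<epsilon> ^ n" "\<forall>\<^sub>F \<epsilon> in at_bot. \<bar>y \<epsilon> - y' \<epsilon>\<bar> \<le> \<rho> \<epsilon> ^ n"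
    using assms by (auto simp: net_sim_def)
  then show "\<forall>\<^sub>F \<epsilon> in at_bot. \<bar>x \<epsilon> * y \<epsilon> - x' \<epsilon> * y' \<epsilon>\<bar> \<le> \<bar>\<bar>x \<epsilon>\<bar> + \<bar>y' \<epsilon>\<bar>\<bar> * \<rho> \<epsilon> ^ n"
  proof eventually_elim
    case (elim \<epsilon>)
    have "x \<epsilon> * y \<epsilon> - x' \<epsilon> * y' \<epsilon> = x \<epsilon> * (y \<epsilon> - y' \<epsilon>) + y' \<epsilon> * (x \<epsilon> - x' \<epsilon>)"
      by (simp add: algebra_simps)
    also have "\<bar>\<dots>\<bar> \<le> \<bar>x \<epsilon>\<bar> * \<bar>y \<epsilon> - y' \<epsilon>\<bar> + \<bar>y' \<epsilon>\<bar> * \<bar>x \<epsilon> - x' \<epsilon>\<bar>"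
      by (rule abs_triangle_ineq[THEN order_trans]) (simp add: abs_mult)
    also have "\<dots> \<le> \<bar>x \<epsilon>\<bar> * \<rho> \<epsilon> ^ n + \<bar>y' \<epsilon>\<bar> * \<rho> \<epsilon> ^ n"
      by (intro add_mono mult_left_mono elim) auto
    finally show ?case by (simp add: algebra_simps)
  qed
qed

lemma equiv_net_rel: "equiv (moderate \<rho>) (net_rel \<rho>)"
proof (rule equivI)
  show "net_rel \<rho> \<subseteq> moderate \<rho> \<times> moderate \<rho>" by (auto simp: net_rel_def)
  show "refl_on (moderate \<rho>) (net_rel \<rho>)" by (auto simp: net_rel_def refl_on_def net_sim_refl)
  show "sym (net_rel \<rho>)" by (auto simp: net_rel_def sym_def net_sim_sym)
  show "trans (net_rel \<rho>)" unfolding net_rel_def trans_def by (blast intro: net_sim_trans)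
qed

lemma gring_cases:
  assumes "X \<in> carrier (gring \<rho>)"
  obtains x where "x \<in> moderate \<rho>" "X = gcls \<rho> x"
  using assms by (auto simp: gring_def gcls_def elim: quotientE)

lemma gcls_closed: "x \<in> moderate \<rho> \<Longrightarrow> gcls \<rho> x \<in> carrier (gring \<rho>)"
  by (simp add: gring_def gcls_def quotientI)

lemma gcls_eq_iff:
  "x \<in> moderate \<rho> \<Longrightarrow> y \<in> moderate \<rho> \<Longrightarrow> gcls \<rho> x = gcls \<rho> y \<longleftrightarrow> net_sim \<rho> x y"
  unfolding gcls_def by (simp add: eq_equiv_class_iff[OF equiv_net_rel]) (simp add: net_rel_def)

lemma in_gcls_iff: "x \<in> moderate \<rho> \<Longrightarrow> y \<in> gcls \<rho> x \<longleftrightarrow> y \<in> moderate \<rho> \<and> net_sim \<rho> x y"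
  by (auto simp: gcls_def net_rel_def)

lemma gring_one: "\<one>\<^bsub>gring \<rho>\<^esub> = gcls \<rho> (\<lambda>_. 1)" and gring_zero: "\<zero>\<^bsub>gring \<rho>\<^esub> = gcls \<rho> (\<lambda>_. 0)"
  by (simp_all add: gring_def)

lemma gring_add:
  assumes "x \<in> moderate \<rho>" "y \<in> moderate \<rho>"
  shows "gcls \<rho> x \<oplus>\<^bsub>gring \<rho>\<^esub> gcls \<rho> y = gcls \<rho> (\<lambda>\<epsilon>. x \<epsilon> + y \<epsilon>)"
proof -
  have "gcls \<rho> (\<lambda>\<epsilon>. x' \<epsilon> + y' \<epsilon>) = gcls \<rho> (\<lambda>\<epsilon>. x \<epsilon> + y \<epsilon>)"
    if "x' \<in> gcls \<rho> x" "y' \<in> gcls \<rho> y" for x' y'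
  proof -
    have m: "x' \<in> moderate \<rho>" "y' \<in> moderate \<rho>" and sim: "net_sim \<rho> x x'" "net_sim \<rho> y y'"
      using that assms by (simp_all add: in_gcls_iff)
    have "net_sim \<rho> (\<lambda>\<epsilon>. x' \<epsilon> + y' \<epsilon>) (\<lambda>\<epsilon>. x \<epsilon> + y \<epsilon>)"
      by (rule net_sim_sym, rule net_sim_add) (fact sim assms m)+
    with m assms show ?thesis by (simp add: gcls_eq_iff moderate_add)
  qed
  then have "(\<Union>x'\<in>gcls \<rho> x. \<Union>y'\<in>gcls \<rho> y. gcls \<rho> (\<lambda>\<epsilon>. x' \<epsilon> + y' \<epsilon>)) =
      (\<Union>x'\<in>gcls \<rho> x. \<Union>y'\<in>gcls \<rho> y. gcls \<rho> (\<lambda>\<epsilon>. x \<epsilon> + y \<epsilon>))"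
    by (intro SUP_cong refl)
  moreover have "x \<in> gcls \<rho> x" "y \<in> gcls \<rho> y"
    using assms by (simp_all add: in_gcls_iff net_sim_refl)
  then have "gcls \<rho> x \<noteq> {}" "gcls \<rho> y \<noteq> {}" by auto
  ultimately show ?thesis by (simp add: gring_def)
qed

lemma gring_mult:
  assumes "x \<in> moderate \<rho>" "y \<in> moderate \<rho>"
  shows "gcls \<rho> x \<otimes>\<^bsub>gring \<rho>\<^esub> gcls \<rho> y = gcls \<rho> (\<lambda>\<epsilon>. x \<epsilon> * y \<epsilon>)"
proof -
  have "gcls \<rho> (\<lambda>\<epsilon>. x' \<epsilon> * y' \<epsilon>) = gcls \<rho> (\<lambda>\<epsilon>. x \<epsilon> * y \<epsilon>)"
    if "x' \<in> gcls \<rho> x" "y' \<in> gcls \<rho> y" for x' y'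
  proof -
    have m: "x' \<in> moderate \<rho>" "y' \<in> moderate \<rho>" and sim: "net_sim \<rho> x x'" "net_sim \<rho> y y'"
      using that assms by (simp_all add: in_gcls_iff)
    have "net_sim \<rho> (\<lambda>\<epsilon>. x' \<epsilon> * y' \<epsilon>) (\<lambda>\<epsilon>. x \<epsilon> * y \<epsilon>)"
      by (rule net_sim_sym, rule net_sim_mult) (fact sim assms m)+
    with m assms show ?thesis by (simp add: gcls_eq_iff moderate_mult)
  qed
  then have "(\<Union>x'\<in>gcls \<rho> x. \<Union>y'\<in>gcls \<rho> y. gcls \<rho> (\<lambda>\<epsilon>. x' \<epsilon> * y' \<epsilon>)) =
      (\<Union>x'\<in>gcls \<rho> x. \<Union>y'\<in>gcls \<rho> y. gcls \<rho> (\<lambda>\<epsilon>. x \<epsilon> * y \<epsilon>))"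
    by (intro SUP_cong refl)
  moreover have "x \<in> gcls \<rho> x" "y \<in> gcls \<rho> y"
    using assms by (simp_all add: in_gcls_iff net_sim_refl)
  then have "gcls \<rho> x \<noteq> {}" "gcls \<rho> y \<noteq> {}" by auto
  ultimately show ?thesis by (simp add: gring_def)
qed

lemma gabs_gcls:
  assumes "x \<in> moderate \<rho>"
  shows "gabs \<rho> (gcls \<rho> x) = gcls \<rho> (\<lambda>\<epsilon>. \<bar>x \<epsilon>\<bar>)"
proof -
  have "gcls \<rho> (\<lambda>\<epsilon>. \<bar>x' \<epsilon>\<bar>) = gcls \<rho> (\<lambda>\<epsilon>. \<bar>x \<epsilon>\<bar>)" if "x' \<in> gcls \<rho> x" for x'
  proof -
    have m: "x' \<in> moderate \<rho>" and sim: "net_sim \<rho> x x'"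
      using that assms by (simp_all add: in_gcls_iff)
    have "net_sim \<rho> (\<lambda>\<epsilon>. \<bar>x' \<epsilon>\<bar>) (\<lambda>\<epsilon>. \<bar>x \<epsilon>\<bar>)"
      by (rule net_sim_sym, rule net_sim_abs) (fact sim)
    with m assms show ?thesis by (simp add: gcls_eq_iff moderate_abs)
  qed
  then have "(\<Union>x'\<in>gcls \<rho> x. gcls \<rho> (\<lambda>\<epsilon>. \<bar>x' \<epsilon>\<bar>)) = (\<Union>x'\<in>gcls \<rho> x. gcls \<rho> (\<lambda>\<epsilon>. \<bar>x \<epsilon>\<bar>))"
    by (intro SUP_cong refl)
  moreover have "x \<in> gcls \<rho> x"
    using assms by (simp add: in_gcls_iff net_sim_refl)
  then have "gcls \<rho> x \<noteq> {}" by auto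
  ultimately show ?thesis by (simp add: gabs_def)
qed

lemma cring_gring: "cring (gring \<rho>)"
proof (rule cringI)
  note cl = gring_add gring_mult gring_zero gring_one moderate_add moderate_mult moderate_const
    gcls_closed
  show "abelian_group (gring \<rho>)"
  proof (rule abelian_groupI)
    fix X assume "X \<in> carrier (gring \<rho>)"
    then obtain x where x: "x \<in> moderate \<rho>" "X = gcls \<rho> x" by (rule gring_cases)
    then show "\<exists>Y\<in>carrier (gring \<rho>). Y \<oplus>\<^bsub>gring \<rho>\<^esub> X = \<zero>\<^bsub>gring \<rho>\<^esub>"
      by (intro bexI[of _ "gcls \<rho> (\<lambda>\<epsilon>. - x \<epsilon>)"]) (simp_all add: cl moderate_uminus)
    from x show "\<zero>\<^bsub>gring \<rho>\<^esub> \<oplus>\<^bsub>gring \<rho>\<^esub> X = X" by (simp add: cl)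
    fix Y assume "Y \<in> carrier (gring \<rho>)"
    then obtain y where y: "y \<in> moderate \<rho>" "Y = gcls \<rho> y" by (rule gring_cases)
    from x y show "X \<oplus>\<^bsub>gring \<rho>\<^esub> Y \<in> carrier (gring \<rho>)"
      and "X \<oplus>\<^bsub>gring \<rho>\<^esub> Y = Y \<oplus>\<^bsub>gring \<rho>\<^esub> X" by (simp_all add: cl add.commute)
    fix Z assume "Z \<in> carrier (gring \<rho>)"
    then obtain z where "z \<in> moderate \<rho>" "Z = gcls \<rho> z" by (rule gring_cases)
    with x y show "X \<oplus>\<^bsub>gring \<rho>\<^esub> Y \<oplus>\<^bsub>gring \<rho>\<^esub> Z = X \<oplus>\<^bsub>gring \<rho>\<^esub> (Y \<oplus>\<^bsub>gring \<rho>\<^esub> Z)"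
      by (simp add: cl add.assoc)
  qed (simp add: cl)
  show "Group.comm_monoid (gring \<rho>)"
  proof (rule comm_monoidI)
    fix X assume "X \<in> carrier (gring \<rho>)"
    then obtain x where x: "x \<in> moderate \<rho>" "X = gcls \<rho> x" by (rule gring_cases)
    from x show "\<one>\<^bsub>gring \<rho>\<^esub> \<otimes>\<^bsub>gring \<rho>\<^esub> X = X" by (simp add: cl)
    fix Y assume "Y \<in> carrier (gring \<rho>)"
    then obtain y where y: "y \<in> moderate \<rho>" "Y = gcls \<rho> y" by (rule gring_cases)
    from x y show "X \<otimes>\<^bsub>gring \<rho>\<^esub> Y \<in> carrier (gring \<rho>)"
      and "X \<otimes>\<^bsub>gring \<rho>\<^esub> Y = Y \<otimes>\<^bsub>gring \<rho>\<^esub> X" by (simp_all add: cl mult.commute)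
    fix Z assume "Z \<in> carrier (gring \<rho>)"
    then obtain z where "z \<in> moderate \<rho>" "Z = gcls \<rho> z" by (rule gring_cases)
    with x y show "X \<otimes>\<^bsub>gring \<rho>\<^esub> Y \<otimes>\<^bsub>gring \<rho>\<^esub> Z = X \<otimes>\<^bsub>gring \<rho>\<^esub> (Y \<otimes>\<^bsub>gring \<rho>\<^esub> Z)"
      by (simp add: cl mult.assoc)
  qed (simp add: cl)
  fix X Y Z
  assume "X \<in> carrier (gring \<rho>)" "Y \<in> carrier (gring \<rho>)" "Z \<in> carrier (gring \<rho>)"
  then obtain x y z where "x \<in> moderate \<rho>" "X = gcls \<rho> x" "y \<in> moderate \<rho>" "Y = gcls \<rho> y"
    "z \<in> moderate \<rho>" "Z = gcls \<rho> z"
    by (elim gring_cases) blast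
  then show "(X \<oplus>\<^bsub>gring \<rho>\<^esub> Y) \<otimes>\<^bsub>gring \<rho>\<^esub> Z =
      X \<otimes>\<^bsub>gring \<rho>\<^esub> Z \<oplus>\<^bsub>gring \<rho>\<^esub> Y \<otimes>\<^bsub>gring \<rho>\<^esub> Z"
    by (simp add: cl distrib_right)
qed

lemma gring_minus:
  assumes "x \<in> moderate \<rho>" "y \<in> moderate \<rho>"
  shows "gcls \<rho> x \<ominus>\<^bsub>gring \<rho>\<^esub> gcls \<rho> y = gcls \<rho> (\<lambda>\<epsilon>. x \<epsilon> - y \<epsilon>)"
proof -
  interpret cring "gring \<rho>" by (rule cring_gring)
  have "\<ominus>\<^bsub>gring \<rho>\<^esub> gcls \<rho> y = gcls \<rho> (\<lambda>\<epsilon>. - y \<epsilon>)"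
    using assms
    by (intro minus_equality) (simp_all add: gring_add gring_zero moderate_uminus gcls_closed)
  with assms show ?thesis
    by (simp add: a_minus_def gring_add moderate_uminus)
qed

lemma gle_gcls_iff:
  assumes "x \<in> moderate \<rho>" "y \<in> moderate \<rho>"
  shows "gle \<rho> (gcls \<rho> x) (gcls \<rho> y) \<longleftrightarrow>
    (\<exists>z. negligible_net \<rho> z \<and> (\<forall>\<^sub>F \<epsilon> in at_bot. x \<epsilon> \<le> y \<epsilon> + z \<epsilon>))"
proof
  assume "gle \<rho> (gcls \<rho> x) (gcls \<rho> y)"
  then obtain x' y' z where sim: "net_sim \<rho> x x'" "net_sim \<rho> y y'" and z: "net_sim \<rho> z (\<lambda>_. 0)"
    and le: "\<forall>\<^sub>F \<epsilon> in at_bot. x' \<epsilon> \<le> y' \<epsilon> + z \<epsilon>"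
    using assms unfolding gle_def negligible_net_def by (auto simp: in_gcls_iff)
  let ?z = "\<lambda>\<epsilon>. (\<bar>x \<epsilon> - x' \<epsilon>\<bar> + \<bar>y \<epsilon> - y' \<epsilon>\<bar>) + z \<epsilon>"
  have "net_sim \<rho> (\<lambda>\<epsilon>. \<bar>x \<epsilon> - x' \<epsilon>\<bar>) (\<lambda>_. 0)" "net_sim \<rho> (\<lambda>\<epsilon>. \<bar>y \<epsilon> - y' \<epsilon>\<bar>) (\<lambda>_. 0)"
    using sim by (simp_all add: net_sim_def)
  then have "net_sim \<rho> ?z (\<lambda>_. (0 + 0) + 0)"
    by (intro net_sim_add z)
  moreover have "\<forall>\<^sub>F \<epsilon> in at_bot. x \<epsilon> \<le> y \<epsilon> + ?z \<epsilon>"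
    using le by eventually_elim linarith
  ultimately show "\<exists>z. negligible_net \<rho> z \<and> (\<forall>\<^sub>F \<epsilon> in at_bot. x \<epsilon> \<le> y \<epsilon> + z \<epsilon>)"
    by (auto simp: negligible_net_def)
next
  assume "\<exists>z. negligible_net \<rho> z \<and> (\<forall>\<^sub>F \<epsilon> in at_bot. x \<epsilon> \<le> y \<epsilon> + z \<epsilon>)"
  moreover have "x \<in> gcls \<rho> x" "y \<in> gcls \<rho> y"
    using assms by (auto simp: in_gcls_iff net_sim_refl)
  ultimately show "gle \<rho> (gcls \<rho> x) (gcls \<rho> y)"
    unfolding gle_def by blast
qed

end

definition sharp_ball :: "(idx \<Rightarrow> real) \<Rightarrow> (idx \<Rightarrow> real) set \<Rightarrow> (idx \<Rightarrow> real) set \<Rightarrow> (idx \<Rightarrow> real) set set"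
  where "sharp_ball \<rho> r x =
    {y \<in> carrier (gring \<rho>). glt \<rho> (gabs \<rho> (y \<ominus>\<^bsub>gring \<rho>\<^esub> x)) r}"

definition sharp_topology :: "(idx \<Rightarrow> real) \<Rightarrow> (idx \<Rightarrow> real) set topology"
  where "sharp_topology \<rho> = topology_generated_by
    {sharp_ball \<rho> r x | r x. r \<in> carrier (gring \<rho>) \<and> x \<in> carrier (gring \<rho>) \<and> glt \<rho> \<zero>\<^bsub>gring \<rho>\<^esub> r}"

definition gupper :: "(idx \<Rightarrow> real) \<Rightarrow> (idx \<Rightarrow> real) set set \<Rightarrow> (idx \<Rightarrow> real) set \<Rightarrow> bool"
  where "gupper \<rho> S u \<longleftrightarrow> u \<in> carrier (gring \<rho>) \<and> (\<forall>s\<in>S. gle \<rho> s u)"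

definition is_sharp_sup :: "(idx \<Rightarrow> real) \<Rightarrow> (idx \<Rightarrow> real) set set \<Rightarrow> (idx \<Rightarrow> real) set \<Rightarrow> bool"
  where "is_sharp_sup \<rho> S s \<longleftrightarrow> gupper \<rho> S s \<and> s \<in> Abstract_Topology.closure_of (sharp_topology \<rho>) S"

definition hypernat :: "(idx \<Rightarrow> real) \<Rightarrow> (idx \<Rightarrow> real) set set"
  where "hypernat \<sigma> = {gcls \<sigma> n | n. n \<in> moderate \<sigma> \<and> (\<forall>\<epsilon>. n \<epsilon> \<in> \<nat>)}"

definition hyperseq ::
  "(idx \<Rightarrow> real) \<Rightarrow> (idx \<Rightarrow> real) \<Rightarrow> ((idx \<Rightarrow> real) set \<Rightarrow> (idx \<Rightarrow> real) set) \<Rightarrow> bool"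
  where "hyperseq \<sigma> \<rho> x \<longleftrightarrow> x \<in> hypernat \<sigma> \<rightarrow> carrier (gring \<rho>)"

definition nondecreasing_hyperseq ::
  "(idx \<Rightarrow> real) \<Rightarrow> (idx \<Rightarrow> real) \<Rightarrow> ((idx \<Rightarrow> real) set \<Rightarrow> (idx \<Rightarrow> real) set) \<Rightarrow> bool"
  where "nondecreasing_hyperseq \<sigma> \<rho> x \<longleftrightarrow>
    (\<forall>n\<in>hypernat \<sigma>. \<forall>m\<in>hypernat \<sigma>. gle \<sigma> m n \<longrightarrow> gle \<rho> (x m) (x n))"

definition is_hyperlimit ::
  "(idx \<Rightarrow> real) \<Rightarrow> (idx \<Rightarrow> real) \<Rightarrow> ((idx \<Rightarrow> real) set \<Rightarrow> (idx \<Rightarrow> real) set) \<Rightarrow> (idx \<Rightarrow> real) set \<Rightarrow> bool"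
  where "is_hyperlimit \<sigma> \<rho> x l \<longleftrightarrow> l \<in> carrier (gring \<rho>) \<and>
    (\<forall>q::nat. \<exists>M\<in>hypernat \<sigma>. \<forall>n\<in>hypernat \<sigma>. gle \<sigma> M n \<longrightarrow>
      glt \<rho> (gabs \<rho> (x n \<ominus>\<^bsub>gring \<rho>\<^esub> l)) (gcls \<rho> \<rho> [^]\<^bsub>gring \<rho>\<^esub> q))"

text \<open>
  The two families of choices of representatives: \<open>ur u\<close> is the net chosen for the upper
  bound \<open>u\<close>, and \<open>sr v s\<close> is the representative of \<open>s\<close> associated with the net \<open>v\<close>. The nets
  \<open>v\<close> are \<open>ereal\<close>-valued, so that \<open>sr\<close> can be applied to the net \<open>upper_net\<close> below even when some of
  its values are \<open>-\<infinity>\<close>; for such a net any representative is allowed.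
\<close>

definition repr_choice ::
  "(idx \<Rightarrow> real) \<Rightarrow> (idx \<Rightarrow> real) set set \<Rightarrow> ((idx \<Rightarrow> real) set \<Rightarrow> idx \<Rightarrow> real) \<Rightarrow>
    ((idx \<Rightarrow> ereal) \<Rightarrow> (idx \<Rightarrow> real) set \<Rightarrow> idx \<Rightarrow> real) \<Rightarrow> bool"
  where "repr_choice \<rho> S ur sr \<longleftrightarrow>
    (\<forall>u. gupper \<rho> S u \<longrightarrow> ur u \<in> u) \<and>
    (\<forall>v. \<forall>s\<in>S. sr v s \<in> s) \<and>
    (\<forall>v\<in>moderate \<rho>. \<forall>s\<in>S. gle \<rho> s (gcls \<rho> v) \<longrightarrow>
      (\<forall>\<epsilon>. sr (\<lambda>\<epsilon>. ereal (v \<epsilon>)) s \<epsilon> \<le> v \<epsilon>))"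

lemma repr_choice_exists:
  assumes \<rho>: "gauge_net \<rho>" and S: "S \<subseteq> carrier (gring \<rho>)"
  shows "\<exists>ur sr. repr_choice \<rho> S ur sr"
proof -
  have ne: "\<exists>r. r \<in> X" if "X \<in> carrier (gring \<rho>)" for X
    using that gring_cases[OF \<rho>] in_gcls_iff[OF \<rho>] net_sim_refl[OF \<rho>] by metis
  have below: "\<exists>r\<in>s. \<forall>\<epsilon>. r \<epsilon> \<le> v \<epsilon>" if sv: "s \<in> S" "v \<in> moderate \<rho>" "gle \<rho> s (gcls \<rho> v)" for s v
  proof -
    have "s \<in> carrier (gring \<rho>)" using sv S by blast
    then obtain y where y: "y \<in> moderate \<rho>" "s = gcls \<rho> y"
      by (rule gring_cases[OF \<rho>])
    then obtain z where z: "negligible_net \<rho> z" "\<forall>\<^sub>F \<epsilon> in at_bot. y \<epsilon> \<le> v \<epsilon> + z \<epsilon>"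
      using sv gle_gcls_iff[OF \<rho>] by blast
    let ?r = "\<lambda>\<epsilon>. min (y \<epsilon>) (v \<epsilon>)"
    have "net_sim \<rho> y ?r"
      unfolding net_sim_def
    proof
      fix n
      have "\<forall>\<^sub>F \<epsilon> in at_bot. \<bar>z \<epsilon> - 0\<bar> \<le> \<rho> \<epsilon> ^ n"
        using z(1) unfolding negligible_net_def net_sim_def by blast
      then show "\<forall>\<^sub>F \<epsilon> in at_bot. \<bar>y \<epsilon> - ?r \<epsilon>\<bar> \<le> \<rho> \<epsilon> ^ n"
        using z(2) by eventually_elim linarith
    qed
    moreover have "?r \<in> moderate \<rho>"
      by (rule moderate_bound[OF \<rho> moderate_add[OF \<rho> moderate_abs moderate_abs, OF \<rho> y(1) \<rho> sv(2)]])
        (intro always_eventually allI, simp add: min_def)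
    ultimately show ?thesis
      using y in_gcls_iff[OF \<rho>] by (intro bexI[of _ ?r]) auto
  qed
  define P where "P v s r \<longleftrightarrow> r \<in> s \<and>
    (\<forall>w\<in>moderate \<rho>. v = (\<lambda>\<epsilon>. ereal (w \<epsilon>)) \<longrightarrow> gle \<rho> s (gcls \<rho> w) \<longrightarrow> (\<forall>\<epsilon>. r \<epsilon> \<le> w \<epsilon>))"
    for v :: "idx \<Rightarrow> ereal" and s and r :: "idx \<Rightarrow> real"
  have ex: "\<exists>r. P v s r" if s: "s \<in> S" for v s
  proof (cases "\<exists>w\<in>moderate \<rho>. v = (\<lambda>\<epsilon>. ereal (w \<epsilon>)) \<and> gle \<rho> s (gcls \<rho> w)")
    case True
    then obtain w where w: "w \<in> moderate \<rho>" "v = (\<lambda>\<epsilon>. ereal (w \<epsilon>))" "gle \<rho> s (gcls \<rho> w)" by blast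
    obtain r where "r \<in> s" "\<forall>\<epsilon>. r \<epsilon> \<le> w \<epsilon>"
      using below[OF s w(1,3)] by blast
    with w have "P v s r" by (auto simp: P_def fun_eq_iff)
    then show ?thesis by blast
  next
    case False
    then show ?thesis using ne s S unfolding P_def by blast
  qed
  have "repr_choice \<rho> S (\<lambda>u. SOME r. r \<in> u) (\<lambda>v s. SOME r. P v s r)"
    unfolding repr_choice_def
  proof (intro conjI ballI allI impI)
    fix u assume "gupper \<rho> S u"
    then show "(SOME r. r \<in> u) \<in> u" using ne someI_ex by (metis gupper_def)
  next
    fix v s assume "s \<in> S"
    from someI_ex[OF ex[OF this, of v]] show "(SOME r. P v s r) \<in> s" by (simp add: P_def)
  next
    fix v s \<epsilon> assume "v \<in> moderate \<rho>" "s \<in> S" "gle \<rho> s (gcls \<rho> v)"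
    then show "(SOME r. P (\<lambda>\<epsilon>. ereal (v \<epsilon>)) s r) \<epsilon> \<le> v \<epsilon>"
      using someI_ex[OF ex, of s "\<lambda>\<epsilon>. ereal (v \<epsilon>)"] by (simp add: P_def)
  qed
  then show ?thesis by blast
qed

text \<open>The infimum and supremum are taken in \<open>ereal\<close>, where \<open>Inf {} = \<infinity>\<close> and \<open>Sup {} = -\<infinity>\<close>.\<close>

definition upper_net ::
  "(idx \<Rightarrow> real) \<Rightarrow> (idx \<Rightarrow> real) set set \<Rightarrow> ((idx \<Rightarrow> real) set \<Rightarrow> idx \<Rightarrow> real) \<Rightarrow>
    ((idx \<Rightarrow> ereal) \<Rightarrow> (idx \<Rightarrow> real) set \<Rightarrow> idx \<Rightarrow> real) \<Rightarrow> idx \<Rightarrow> ereal"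
  where "upper_net \<rho> S ur sr \<epsilon> =
    (INF u\<in>{u. gupper \<rho> S u}. SUP s\<in>S. ereal (sr (\<lambda>\<epsilon>'. ereal (ur u \<epsilon>')) s \<epsilon>))"

definition complete_from_above ::
  "(idx \<Rightarrow> real) \<Rightarrow> (idx \<Rightarrow> real) set set \<Rightarrow> ((idx \<Rightarrow> real) set \<Rightarrow> idx \<Rightarrow> real) \<Rightarrow>
    ((idx \<Rightarrow> ereal) \<Rightarrow> (idx \<Rightarrow> real) set \<Rightarrow> idx \<Rightarrow> real) \<Rightarrow> bool"
  where "complete_from_above \<rho> S ur sr \<longleftrightarrow>
    (\<forall>s\<in>S. \<exists>r\<in>s. \<forall>\<^sub>F \<epsilon> in at_bot. ereal (r \<epsilon>) \<le> upper_net \<rho> S ur sr \<epsilon>) \<and>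
    (\<forall>F :: idx \<Rightarrow> (idx \<Rightarrow> real) set. (\<forall>e. F e \<in> S) \<longrightarrow>
      (\<exists>u\<in>moderate \<rho>. \<forall>e. \<forall>\<^sub>F \<epsilon> in at_bot. sr (upper_net \<rho> S ur sr) (F e) \<epsilon> \<le> u \<epsilon>) \<longrightarrow>
      (\<exists>t\<in>moderate \<rho>. gcls \<rho> t \<in> Abstract_Topology.closure_of (sharp_topology \<rho>) S \<and>
        (\<forall>\<^sub>F \<epsilon> in at_bot. sr (upper_net \<rho> S ur sr) (F \<epsilon>) \<epsilon> \<le> t \<epsilon>)))"

end

theory Submission
  imports Defs
begin

text \<open>
  A hyperlimit of a non-decreasing hypersequence is an upper bound in the closure of its range,
  and conversely, by squeezing. For the existence criterion, the only property of the range that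
  matters is that it has a countable cofinal subset, given by the indices
  \<open>[\<lceil>\<sigma>\<^sub>\<epsilon>\<^sup>-\<^sup>k\<rceil>]\<close>, \<open>k \<in> \<nat>\<close>. A diagonal family through this sequence, picking
  at each \<open>\<epsilon>\<close> the largest of finitely many representatives, turns condition (2) of
  completeness from above into a single point of the closure that dominates the whole sequence.
\<close>

context
  fixes \<rho> :: "idx \<Rightarrow> real"
  assumes \<rho>: "gauge_net \<rho>"
begin

section \<open>Powers of the gauge and the order in terms of representatives\<close>

text \<open>This takes the place of halving an error bound: once
  \<open>\<rho> \<epsilon> \<le> 1 / 2\<close>, two errors of size
  \<open>\<rho> \<epsilon> ^ Suc m\<close> fit into one of size
  \<open>\<rho> \<epsilon> ^ m\<close>. Later estimates start with extra powers in order to spend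
  them here.\<close>

lemma gauge_power_Suc_le_half: "\<forall>\<^sub>F \<epsilon> in at_bot. 2 * \<rho> \<epsilon> ^ Suc m \<le> \<rho> \<epsilon> ^ m"
  using gauge_le_half[OF \<rho>]
proof eventually_elim
  case (elim \<epsilon>)
  have "(2 * \<rho> \<epsilon>) * \<rho> \<epsilon> ^ m \<le> 1 * \<rho> \<epsilon> ^ m"
    using elim by (intro mult_right_mono) (auto simp: gauge_bounds[OF \<rho>])
  then show ?case by simp
qed

lemma moderate_gauge_power: "(\<lambda>\<epsilon>. \<rho> \<epsilon> ^ n) \<in> moderate \<rho>"
  by (rule moderate_bound[OF \<rho> moderate_const[OF \<rho>, of 1]])
    (simp add: gauge_bounds[OF \<rho>] power_le_one)

lemma moderate_diff:
  "x \<in> moderate \<rho> \<Longrightarrow> y \<in> moderate \<rho> \<Longrightarrow> (\<lambda>\<epsilon>. x \<epsilon> - y \<epsilon>) \<in> moderate \<rho>"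
  using moderate_add[OF \<rho> _ moderate_uminus[OF \<rho>]] by fastforce

lemma gcls_gauge_power: "gcls \<rho> \<rho> [^]\<^bsub>gring \<rho>\<^esub> (q::nat) = gcls \<rho> (\<lambda>\<epsilon>. \<rho> \<epsilon> ^ q)"
proof (induction q)
  case 0
  show ?case by (simp add: Group.nat_pow_0 gring_one[OF \<rho>])
next
  case (Suc q)
  then show ?case
    by (simp add: Group.nat_pow_Suc gring_mult[OF \<rho>] moderate_gauge_power moderate_gauge[OF \<rho>] mult.commute)
qed

text \<open>Trading the existential negligible net for gauge powers turns order statements into
  eventual inequalities that linear arithmetic can combine.\<close>

lemma gle_gcls_iff_power:
  assumes "x \<in> moderate \<rho>" "y \<in> moderate \<rho>"
  shows "gle \<rho> (gcls \<rho> x) (gcls \<rho> y) \<longleftrightarrow> (\<forall>n. \<forall>\<^sub>F \<epsilon> in at_bot. x \<epsilon> \<le> y \<epsilon> + \<rho> \<epsilon> ^ n)"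
    (is "?L \<longleftrightarrow> ?R")
proof
  assume ?L
  then obtain z where z: "negligible_net \<rho> z" "\<forall>\<^sub>F \<epsilon> in at_bot. x \<epsilon> \<le> y \<epsilon> + z \<epsilon>"
    using gle_gcls_iff[OF \<rho> assms] by blast
  show ?R
  proof
    fix n
    have "\<forall>\<^sub>F \<epsilon> in at_bot. \<bar>z \<epsilon> - 0\<bar> \<le> \<rho> \<epsilon> ^ n"
      using z(1) unfolding negligible_net_def net_sim_def by blast
    with z(2) show "\<forall>\<^sub>F \<epsilon> in at_bot. x \<epsilon> \<le> y \<epsilon> + \<rho> \<epsilon> ^ n"
      by eventually_elim linarith
  qed
next
  assume R: ?R
  \<comment> \<open>The positive part of \<open>x - y\<close> is the least nonnegative correction
    that makes the inequality hold at every \<open>\<epsilon>\<close>; the hypothesis says that it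
    is negligible.\<close>
  let ?z = "\<lambda>\<epsilon>. max 0 (x \<epsilon> - y \<epsilon>)"
  have "negligible_net \<rho> ?z"
    unfolding negligible_net_def net_sim_def
  proof
    fix n
    show "\<forall>\<^sub>F \<epsilon> in at_bot. \<bar>?z \<epsilon> - 0\<bar> \<le> \<rho> \<epsilon> ^ n"
      using R[rule_format, of n]
    proof eventually_elim
      case (elim \<epsilon>)
      have "0 \<le> \<rho> \<epsilon> ^ n" by (simp add: gauge_bounds[OF \<rho>])
      with elim show ?case by (auto simp: max_def)
    qed
  qed
  moreover have "\<forall>\<^sub>F \<epsilon> in at_bot. x \<epsilon> \<le> y \<epsilon> + ?z \<epsilon>"
    by (intro always_eventually) (auto simp: max_def)
  ultimately show ?L
    using gle_gcls_iff[OF \<rho> assms] by blast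
qed

lemma gle_gcls_mono:
  assumes "x \<in> moderate \<rho>" "y \<in> moderate \<rho>" "\<forall>\<^sub>F \<epsilon> in at_bot. x \<epsilon> \<le> y \<epsilon>"
  shows "gle \<rho> (gcls \<rho> x) (gcls \<rho> y)"
  unfolding gle_gcls_iff_power[OF assms(1,2)]
proof
  fix n
  show "\<forall>\<^sub>F \<epsilon> in at_bot. x \<epsilon> \<le> y \<epsilon> + \<rho> \<epsilon> ^ n"
    using assms(3)
  proof eventually_elim
    case (elim \<epsilon>)
    have "0 \<le> \<rho> \<epsilon> ^ n" by (simp add: gauge_bounds[OF \<rho>])
    with elim show ?case by linarith
  qed
qed

section \<open>Invertibility and the strict order\<close>

text \<open>If \<open>w\<close> represents an inverse, then eventually
  \<open>\<bar>d \<epsilon> * w \<epsilon>\<bar>\<close> is at least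
  \<open>1 - \<rho> \<epsilon>\<close>, hence at least \<open>\<rho> \<epsilon>\<close>. Since the
  moderate factor \<open>w\<close> is at most \<open>inverse (\<rho> \<epsilon> ^ N)\<close>, the
  factor \<open>d\<close> cannot fall below \<open>\<rho> \<epsilon> ^ Suc N\<close>.\<close>

lemma Units_gring_gcls_lower:
  assumes "d \<in> moderate \<rho>" "gcls \<rho> d \<in> Units (gring \<rho>)"
  shows "\<exists>m. \<forall>\<^sub>F \<epsilon> in at_bot. \<rho> \<epsilon> ^ m \<le> \<bar>d \<epsilon>\<bar>"
proof -
  from assms(2) obtain W where "W \<in> carrier (gring \<rho>)" "gcls \<rho> d \<otimes>\<^bsub>gring \<rho>\<^esub> W = \<one>\<^bsub>gring \<rho>\<^esub>"
    by (auto simp: Units_def)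
  then obtain w where w: "w \<in> moderate \<rho>" and eq: "gcls \<rho> d \<otimes>\<^bsub>gring \<rho>\<^esub> gcls \<rho> w = \<one>\<^bsub>gring \<rho>\<^esub>"
    using gring_cases[OF \<rho>] by metis
  from eq have "net_sim \<rho> (\<lambda>\<epsilon>. d \<epsilon> * w \<epsilon>) (\<lambda>_. 1)"
    by (simp add: gring_mult[OF \<rho>] gring_one[OF \<rho>] assms(1) w gcls_eq_iff[OF \<rho>]
        moderate_mult[OF \<rho>] moderate_const[OF \<rho>])
  then have dw: "\<forall>\<^sub>F \<epsilon> in at_bot. \<bar>d \<epsilon> * w \<epsilon> - 1\<bar> \<le> \<rho> \<epsilon> ^ 1"
    unfolding net_sim_def by blast
  obtain N where N: "\<forall>\<^sub>F \<epsilon> in at_bot. \<bar>w \<epsilon>\<bar> \<le> inverse (\<rho> \<epsilon> ^ N)"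
    using w by (auto simp: moderate_def)
  have "\<forall>\<^sub>F \<epsilon> in at_bot. \<rho> \<epsilon> ^ Suc N \<le> \<bar>d \<epsilon>\<bar>"
    using dw N gauge_le_half[OF \<rho>]
  proof eventually_elim
    case (elim \<epsilon>)
    note pos = gauge_bounds(1)[OF \<rho>, of \<epsilon>]
    have "\<rho> \<epsilon> \<le> \<bar>d \<epsilon> * w \<epsilon>\<bar>" using elim by simp
    also have "\<dots> \<le> \<bar>d \<epsilon>\<bar> * inverse (\<rho> \<epsilon> ^ N)"
      unfolding abs_mult using elim by (intro mult_left_mono) auto
    finally have "\<rho> \<epsilon> * \<rho> \<epsilon> ^ N \<le> \<bar>d \<epsilon>\<bar> * inverse (\<rho> \<epsilon> ^ N) * \<rho> \<epsilon> ^ N"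
      using pos by (intro mult_right_mono) auto
    also have "\<dots> = \<bar>d \<epsilon>\<bar>" using pos by simp
    finally show ?case by simp
  qed
  then show ?thesis by blast
qed

lemma Units_gring_gclsI:
  assumes d: "d \<in> moderate \<rho>" and m: "\<forall>\<^sub>F \<epsilon> in at_bot. \<rho> \<epsilon> ^ m \<le> \<bar>d \<epsilon>\<bar>"
  shows "gcls \<rho> d \<in> Units (gring \<rho>)"
proof -
  \<comment> \<open>Where \<open>d \<epsilon> = 0\<close> this takes the default value 0. The lower
    bound excludes that for all small \<open>\<epsilon>\<close>, and the class depends on nothing
    else.\<close>
  let ?w = "\<lambda>\<epsilon>. inverse (d \<epsilon>)"
  have "\<forall>\<^sub>F \<epsilon> in at_bot. \<bar>?w \<epsilon>\<bar> \<le> inverse (\<rho> \<epsilon> ^ m)"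
    using m
  proof eventually_elim
    case (elim \<epsilon>)
    then show ?case
      unfolding abs_inverse by (intro le_imp_inverse_le) (auto simp: gauge_bounds[OF \<rho>])
  qed
  then have w: "?w \<in> moderate \<rho>" by (auto simp: moderate_def)
  have "net_sim \<rho> (\<lambda>\<epsilon>. d \<epsilon> * ?w \<epsilon>) (\<lambda>_. 1)"
    unfolding net_sim_def
  proof
    fix n
    show "\<forall>\<^sub>F \<epsilon> in at_bot. \<bar>d \<epsilon> * ?w \<epsilon> - 1\<bar> \<le> \<rho> \<epsilon> ^ n"
      using m
    proof eventually_elim
      case (elim \<epsilon>)
      have "0 < \<rho> \<epsilon> ^ m" by (simp add: gauge_bounds[OF \<rho>])
      with elim have "d \<epsilon> \<noteq> 0" by auto
      then show ?case by (simp add: gauge_bounds[OF \<rho>])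
    qed
  qed
  then have "gcls \<rho> d \<otimes>\<^bsub>gring \<rho>\<^esub> gcls \<rho> ?w = \<one>\<^bsub>gring \<rho>\<^esub>"
    "gcls \<rho> ?w \<otimes>\<^bsub>gring \<rho>\<^esub> gcls \<rho> d = \<one>\<^bsub>gring \<rho>\<^esub>"
    by (simp_all add: gring_mult[OF \<rho>] gring_one[OF \<rho>] d w gcls_eq_iff[OF \<rho>]
        moderate_mult[OF \<rho>] moderate_const[OF \<rho>] mult.commute)
  with gcls_closed[OF \<rho>] d w show ?thesis
    unfolding Units_def by blast
qed

text \<open>Invertibility of the difference gives a gauge power as a lower bound for its absolute
  value, and the weak inequality decides its sign.\<close>

lemma glt_gcls_iff:
  assumes x: "x \<in> moderate \<rho>" and y: "y \<in> moderate \<rho>"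
  shows "glt \<rho> (gcls \<rho> x) (gcls \<rho> y) \<longleftrightarrow> (\<exists>m. \<forall>\<^sub>F \<epsilon> in at_bot. x \<epsilon> + \<rho> \<epsilon> ^ m \<le> y \<epsilon>)"
    (is "?L \<longleftrightarrow> ?R")
proof
  assume ?L
  then have le: "\<forall>n. \<forall>\<^sub>F \<epsilon> in at_bot. x \<epsilon> \<le> y \<epsilon> + \<rho> \<epsilon> ^ n"
    and unit: "gcls \<rho> (\<lambda>\<epsilon>. y \<epsilon> - x \<epsilon>) \<in> Units (gring \<rho>)"
    unfolding glt_def gle_gcls_iff_power[OF x y] gring_minus[OF \<rho> y x] by auto
  obtain m where m: "\<forall>\<^sub>F \<epsilon> in at_bot. \<rho> \<epsilon> ^ m \<le> \<bar>y \<epsilon> - x \<epsilon>\<bar>"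
    using Units_gring_gcls_lower[OF moderate_diff[OF y x] unit] by blast
  \<comment> \<open>If \<open>y \<epsilon> - x \<epsilon>\<close> were negative, its absolute value
    would be at most \<open>\<rho> \<epsilon> ^ Suc m\<close>, which is strictly less than
    \<open>\<rho> \<epsilon> ^ m\<close>.\<close>
  have "\<forall>\<^sub>F \<epsilon> in at_bot. x \<epsilon> + \<rho> \<epsilon> ^ m \<le> y \<epsilon>"
    using m le[rule_format, of "Suc m"] gauge_power_Suc_le_half[of m]
  proof eventually_elim
    case (elim \<epsilon>)
    have "0 < \<rho> \<epsilon> ^ Suc m" by (simp add: gauge_bounds[OF \<rho>])
    with elim show ?case by linarith
  qed
  then show ?R by blast
next
  assume ?R
  then obtain m where m: "\<forall>\<^sub>F \<epsilon> in at_bot. x \<epsilon> + \<rho> \<epsilon> ^ m \<le> y \<epsilon>" by blast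
  have "\<forall>\<^sub>F \<epsilon> in at_bot. \<rho> \<epsilon> ^ m \<le> \<bar>y \<epsilon> - x \<epsilon>\<bar>"
    using m by eventually_elim linarith
  then have "gcls \<rho> (\<lambda>\<epsilon>. y \<epsilon> - x \<epsilon>) \<in> Units (gring \<rho>)"
    by (rule Units_gring_gclsI[OF moderate_diff[OF y x]])
  moreover have "\<forall>\<^sub>F \<epsilon> in at_bot. x \<epsilon> \<le> y \<epsilon>"
    using m
  proof eventually_elim
    case (elim \<epsilon>)
    have "0 \<le> \<rho> \<epsilon> ^ m" by (simp add: gauge_bounds[OF \<rho>])
    with elim show ?case by linarith
  qed
  then have "gle \<rho> (gcls \<rho> x) (gcls \<rho> y)"
    by (rule gle_gcls_mono[OF x y])
  ultimately show ?L
    by (simp add: glt_def gring_minus[OF \<rho> y x])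
qed

lemma glt_gabs_gcls_iff:
  assumes "x \<in> moderate \<rho>" "y \<in> moderate \<rho>" "r \<in> moderate \<rho>"
  shows "glt \<rho> (gabs \<rho> (gcls \<rho> x \<ominus>\<^bsub>gring \<rho>\<^esub> gcls \<rho> y)) (gcls \<rho> r)
    \<longleftrightarrow> (\<exists>m. \<forall>\<^sub>F \<epsilon> in at_bot. \<bar>x \<epsilon> - y \<epsilon>\<bar> + \<rho> \<epsilon> ^ m \<le> r \<epsilon>)"
  using assms by (simp add: gring_minus[OF \<rho>] gabs_gcls[OF \<rho>] moderate_diff
      moderate_abs[OF \<rho>] glt_gcls_iff)

text \<open>A strict inequality of classes requires a margin of some gauge power, and the additional
  factor \<open>\<rho> \<epsilon>\<close> in the hypothesis provides it. The converse
  \<open>glt_gabs_gcls_powerD\<close> needs no such shift.\<close>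

lemma glt_gabs_gcls_powerI:
  assumes "x \<in> moderate \<rho>" "y \<in> moderate \<rho>"
    and "\<forall>\<^sub>F \<epsilon> in at_bot. \<bar>x \<epsilon> - y \<epsilon>\<bar> \<le> \<rho> \<epsilon> ^ Suc q"
  shows "glt \<rho> (gabs \<rho> (gcls \<rho> x \<ominus>\<^bsub>gring \<rho>\<^esub> gcls \<rho> y)) (gcls \<rho> \<rho> [^]\<^bsub>gring \<rho>\<^esub> q)"
proof -
  have "\<forall>\<^sub>F \<epsilon> in at_bot. \<bar>x \<epsilon> - y \<epsilon>\<bar> + \<rho> \<epsilon> ^ Suc q \<le> \<rho> \<epsilon> ^ q"
    using assms(3) gauge_power_Suc_le_half[of q] by eventually_elim linarith
  then show ?thesis
    unfolding gcls_gauge_power glt_gabs_gcls_iff[OF assms(1,2) moderate_gauge_power] by blast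
qed

lemma glt_gabs_gcls_powerD:
  assumes "x \<in> moderate \<rho>" "y \<in> moderate \<rho>"
    and "glt \<rho> (gabs \<rho> (gcls \<rho> x \<ominus>\<^bsub>gring \<rho>\<^esub> gcls \<rho> y)) (gcls \<rho> \<rho> [^]\<^bsub>gring \<rho>\<^esub> q)"
  shows "\<forall>\<^sub>F \<epsilon> in at_bot. \<bar>x \<epsilon> - y \<epsilon>\<bar> \<le> \<rho> \<epsilon> ^ q"
proof -
  obtain m where "\<forall>\<^sub>F \<epsilon> in at_bot. \<bar>x \<epsilon> - y \<epsilon>\<bar> + \<rho> \<epsilon> ^ m \<le> \<rho> \<epsilon> ^ q"
    using assms(3) unfolding gcls_gauge_power glt_gabs_gcls_iff[OF assms(1,2) moderate_gauge_power]
    by blast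
  then show ?thesis
  proof eventually_elim
    case (elim \<epsilon>)
    have "0 \<le> \<rho> \<epsilon> ^ m" by (simp add: gauge_bounds[OF \<rho>])
    with elim show ?case by linarith
  qed
qed

section \<open>Neighbourhoods and closure in the sharp topology\<close>

lemma gcls_in_sharp_ball_iff:
  assumes "x \<in> moderate \<rho>" "y \<in> moderate \<rho>" "r \<in> moderate \<rho>"
  shows "gcls \<rho> y \<in> sharp_ball \<rho> (gcls \<rho> r) (gcls \<rho> x)
    \<longleftrightarrow> (\<exists>m. \<forall>\<^sub>F \<epsilon> in at_bot. \<bar>y \<epsilon> - x \<epsilon>\<bar> + \<rho> \<epsilon> ^ m \<le> r \<epsilon>)"
  using assms by (simp add: sharp_ball_def gcls_closed[OF \<rho>] glt_gabs_gcls_iff)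

text \<open>The topology is generated by balls of arbitrary radii and centres, so the proof is an
  induction over the generation of open sets. The outcome is that gauge powers suffice as radii
  around a given point.\<close>

lemma sharp_open_contains_power_ball:
  assumes "openin (sharp_topology \<rho>) T" "gcls \<rho> s \<in> T" and s: "s \<in> moderate \<rho>"
  shows "\<exists>q. \<forall>y\<in>moderate \<rho>. (\<forall>\<^sub>F \<epsilon> in at_bot. \<bar>y \<epsilon> - s \<epsilon>\<bar> \<le> \<rho> \<epsilon> ^ q) \<longrightarrow> gcls \<rho> y \<in> T"
proof -
  let ?B = "{sharp_ball \<rho> r x | r x. r \<in> carrier (gring \<rho>) \<and> x \<in> carrier (gring \<rho>)
    \<and> glt \<rho> \<zero>\<^bsub>gring \<rho>\<^esub> r}"
  have "generate_topology_on ?B T"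
    using assms(1) by (simp add: sharp_topology_def openin_topology_generated_by_iff)
  then show ?thesis
    using assms(2)
  proof (induction T rule: generate_topology_on.induct)
    case Empty
    then show ?case by simp
  next
    case (Int a b)
    then obtain p q where
      p: "\<forall>y\<in>moderate \<rho>. (\<forall>\<^sub>F \<epsilon> in at_bot. \<bar>y \<epsilon> - s \<epsilon>\<bar> \<le> \<rho> \<epsilon> ^ p) \<longrightarrow> gcls \<rho> y \<in> a" and
      q: "\<forall>y\<in>moderate \<rho>. (\<forall>\<^sub>F \<epsilon> in at_bot. \<bar>y \<epsilon> - s \<epsilon>\<bar> \<le> \<rho> \<epsilon> ^ q) \<longrightarrow> gcls \<rho> y \<in> b"
      by blast
    have "gcls \<rho> y \<in> a \<inter> b"
      if y: "y \<in> moderate \<rho>" "\<forall>\<^sub>F \<epsilon> in at_bot. \<bar>y \<epsilon> - s \<epsilon>\<bar> \<le> \<rho> \<epsilon> ^ (p + q)" for y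
    proof
      have "\<rho> \<epsilon> ^ (p + q) \<le> \<rho> \<epsilon> ^ p" "\<rho> \<epsilon> ^ (p + q) \<le> \<rho> \<epsilon> ^ q" for \<epsilon>
        by (intro power_decreasing; simp add: gauge_bounds[OF \<rho>])+
      then have "\<forall>\<^sub>F \<epsilon> in at_bot. \<bar>y \<epsilon> - s \<epsilon>\<bar> \<le> \<rho> \<epsilon> ^ p" "\<forall>\<^sub>F \<epsilon> in at_bot. \<bar>y \<epsilon> - s \<epsilon>\<bar> \<le> \<rho> \<epsilon> ^ q"
        using y(2) by (auto elim!: eventually_mono intro: order_trans)
      then show "gcls \<rho> y \<in> a" "gcls \<rho> y \<in> b" using p q y(1) by auto
    qed
    then show ?case by blast
  next
    case (UN K)
    then obtain k where "k \<in> K" "gcls \<rho> s \<in> k" by blast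
    with UN.IH[of k] show ?case by blast
  next
    case (Basis b)
    then obtain R X where R: "R \<in> carrier (gring \<rho>)" and X: "X \<in> carrier (gring \<rho>)"
      and b: "b = sharp_ball \<rho> R X"
      by blast
    obtain r where r: "r \<in> moderate \<rho>" "R = gcls \<rho> r" using R by (rule gring_cases[OF \<rho>])
    obtain x where x: "x \<in> moderate \<rho>" "X = gcls \<rho> x" using X by (rule gring_cases[OF \<rho>])
    obtain m where m: "\<forall>\<^sub>F \<epsilon> in at_bot. \<bar>s \<epsilon> - x \<epsilon>\<bar> + \<rho> \<epsilon> ^ m \<le> r \<epsilon>"
      using Basis.prems unfolding b r x gcls_in_sharp_ball_iff[OF x(1) s r(1)] by blast
    \<comment> \<open>Half of the margin \<open>\<rho> \<epsilon> ^ m\<close> of \<open>s\<close>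
      pays for the move from \<open>s\<close> to \<open>y\<close>; the other half remains as the
      margin of \<open>y\<close>.\<close>
    have "gcls \<rho> y \<in> b"
      if y: "y \<in> moderate \<rho>" "\<forall>\<^sub>F \<epsilon> in at_bot. \<bar>y \<epsilon> - s \<epsilon>\<bar> \<le> \<rho> \<epsilon> ^ Suc m" for y
    proof -
      have "\<forall>\<^sub>F \<epsilon> in at_bot. \<bar>y \<epsilon> - x \<epsilon>\<bar> + \<rho> \<epsilon> ^ Suc m \<le> r \<epsilon>"
        using m y(2) gauge_power_Suc_le_half[of m] by eventually_elim linarith
      then show ?thesis
        unfolding b r x gcls_in_sharp_ball_iff[OF x(1) y(1) r(1)] by blast
    qed
    then show ?case by blast
  qed
qed

lemma openin_sharp_power_ball:
  assumes "s \<in> moderate \<rho>"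
  shows "openin (sharp_topology \<rho>) (sharp_ball \<rho> (gcls \<rho> (\<lambda>\<epsilon>. \<rho> \<epsilon> ^ q)) (gcls \<rho> s))"
proof -
  have "\<forall>\<^sub>F \<epsilon> in at_bot. 0 + \<rho> \<epsilon> ^ q \<le> \<rho> \<epsilon> ^ q" by simp
  then have "glt \<rho> \<zero>\<^bsub>gring \<rho>\<^esub> (gcls \<rho> (\<lambda>\<epsilon>. \<rho> \<epsilon> ^ q))"
    unfolding gring_zero[OF \<rho>] glt_gcls_iff[OF moderate_const[OF \<rho>] moderate_gauge_power]
    by blast
  then show ?thesis
    unfolding sharp_topology_def
    by (intro topology_generated_by_Basis)
      (use assms gcls_closed[OF \<rho>] moderate_gauge_power in blast)
qed

lemma gcls_in_sharp_power_ball: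
  assumes "s \<in> moderate \<rho>"
  shows "gcls \<rho> s \<in> sharp_ball \<rho> (gcls \<rho> (\<lambda>\<epsilon>. \<rho> \<epsilon> ^ q)) (gcls \<rho> s)"
  unfolding gcls_in_sharp_ball_iff[OF assms assms moderate_gauge_power]
  by (rule exI[of _ q]) simp

text \<open>Balls whose radius is a gauge power are open, and every open set around the class of
  \<open>s\<close> contains all classes close enough to it in this scale. Writing the set as an
  image of nets supplies a representative for each of its points.\<close>

lemma gcls_in_sharp_closure_iff:
  assumes A: "A \<subseteq> moderate \<rho>" and s: "s \<in> moderate \<rho>"
  shows "gcls \<rho> s \<in> Abstract_Topology.closure_of (sharp_topology \<rho>) (gcls \<rho> ` A)
    \<longleftrightarrow> (\<forall>q. \<exists>a\<in>A. \<forall>\<^sub>F \<epsilon> in at_bot. \<bar>a \<epsilon> - s \<epsilon>\<bar> \<le> \<rho> \<epsilon> ^ q)"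
    (is "?L \<longleftrightarrow> ?R")
proof
  assume L: ?L
  show ?R
  proof
    fix q
    obtain a where a: "a \<in> A" "gcls \<rho> a \<in> sharp_ball \<rho> (gcls \<rho> (\<lambda>\<epsilon>. \<rho> \<epsilon> ^ q)) (gcls \<rho> s)"
      using L openin_sharp_power_ball[OF s, of q] gcls_in_sharp_power_ball[OF s, of q]
      unfolding in_closure_of by blast
    then have "\<forall>\<^sub>F \<epsilon> in at_bot. \<bar>a \<epsilon> - s \<epsilon>\<bar> \<le> \<rho> \<epsilon> ^ q"
      using A s by (intro glt_gabs_gcls_powerD) (auto simp: gcls_gauge_power sharp_ball_def)
    with a show "\<exists>a\<in>A. \<forall>\<^sub>F \<epsilon> in at_bot. \<bar>a \<epsilon> - s \<epsilon>\<bar> \<le> \<rho> \<epsilon> ^ q" by blast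
  qed
next
  assume R: ?R
  have "gcls \<rho> s \<in> topspace (sharp_topology \<rho>)"
    using openin_subset[OF openin_sharp_power_ball[OF s]] gcls_in_sharp_power_ball[OF s] by blast
  moreover have "\<exists>y\<in>gcls \<rho> ` A. y \<in> T" if T: "gcls \<rho> s \<in> T \<and> openin (sharp_topology \<rho>) T" for T
  proof -
    obtain q where "\<forall>y\<in>moderate \<rho>. (\<forall>\<^sub>F \<epsilon> in at_bot. \<bar>y \<epsilon> - s \<epsilon>\<bar> \<le> \<rho> \<epsilon> ^ q) \<longrightarrow> gcls \<rho> y \<in> T"
      using sharp_open_contains_power_ball[OF _ _ s] T by blast
    with R A show ?thesis by blast
  qed
  ultimately show ?L by (auto simp: in_closure_of)
qed

section \<open>Upper bounds and uniqueness of the sharp supremum\<close>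

lemma gupper_gcls_iff:
  assumes "A \<subseteq> moderate \<rho>" "s \<in> moderate \<rho>"
  shows "gupper \<rho> (gcls \<rho> ` A) (gcls \<rho> s) \<longleftrightarrow>
    (\<forall>a\<in>A. \<forall>n. \<forall>\<^sub>F \<epsilon> in at_bot. a \<epsilon> \<le> s \<epsilon> + \<rho> \<epsilon> ^ n)"
proof -
  have "gle \<rho> (gcls \<rho> a) (gcls \<rho> s) \<longleftrightarrow> (\<forall>n. \<forall>\<^sub>F \<epsilon> in at_bot. a \<epsilon> \<le> s \<epsilon> + \<rho> \<epsilon> ^ n)" if "a \<in> A" for a
    using assms that by (intro gle_gcls_iff_power) auto
  then show ?thesis
    using assms(2) by (simp add: gupper_def gcls_closed[OF \<rho>])
qed

lemma gle_antisym:
  assumes "X \<in> carrier (gring \<rho>)" "Y \<in> carrier (gring \<rho>)" "gle \<rho> X Y" "gle \<rho> Y X"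
  shows "X = Y"
proof -
  obtain x where x: "x \<in> moderate \<rho>" "X = gcls \<rho> x" using assms(1) by (rule gring_cases[OF \<rho>])
  obtain y where y: "y \<in> moderate \<rho>" "Y = gcls \<rho> y" using assms(2) by (rule gring_cases[OF \<rho>])
  have "net_sim \<rho> x y"
    unfolding net_sim_def
  proof
    fix n
    have "\<forall>\<^sub>F \<epsilon> in at_bot. x \<epsilon> \<le> y \<epsilon> + \<rho> \<epsilon> ^ n" "\<forall>\<^sub>F \<epsilon> in at_bot. y \<epsilon> \<le> x \<epsilon> + \<rho> \<epsilon> ^ n"
      using assms(3,4) x y by (auto simp: gle_gcls_iff_power)
    then show "\<forall>\<^sub>F \<epsilon> in at_bot. \<bar>x \<epsilon> - y \<epsilon>\<bar> \<le> \<rho> \<epsilon> ^ n"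
      by eventually_elim linarith
  qed
  then show ?thesis using x y by (simp add: gcls_eq_iff[OF \<rho>])
qed

lemma gle_refl: "X \<in> carrier (gring \<rho>) \<Longrightarrow> gle \<rho> X X"
  by (elim gring_cases[OF \<rho>]) (simp add: gle_gcls_mono)

lemma gle_trans:
  assumes "X \<in> carrier (gring \<rho>)" "Y \<in> carrier (gring \<rho>)" "Z \<in> carrier (gring \<rho>)"
    "gle \<rho> X Y" "gle \<rho> Y Z"
  shows "gle \<rho> X Z"
proof -
  obtain x where x: "x \<in> moderate \<rho>" "X = gcls \<rho> x" using assms(1) by (rule gring_cases[OF \<rho>])
  obtain y where y: "y \<in> moderate \<rho>" "Y = gcls \<rho> y" using assms(2) by (rule gring_cases[OF \<rho>])
  obtain z where z: "z \<in> moderate \<rho>" "Z = gcls \<rho> z" using assms(3) by (rule gring_cases[OF \<rho>])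
  have "\<forall>\<^sub>F \<epsilon> in at_bot. x \<epsilon> \<le> z \<epsilon> + \<rho> \<epsilon> ^ n" for n
  proof -
    have "\<forall>\<^sub>F \<epsilon> in at_bot. x \<epsilon> \<le> y \<epsilon> + \<rho> \<epsilon> ^ Suc n" "\<forall>\<^sub>F \<epsilon> in at_bot. y \<epsilon> \<le> z \<epsilon> + \<rho> \<epsilon> ^ Suc n"
      using assms(4,5) x y z gle_gcls_iff_power by blast+
    then show ?thesis using gauge_power_Suc_le_half[of n] by eventually_elim linarith
  qed
  then show ?thesis using x z by (simp add: gle_gcls_iff_power)
qed

text \<open>An element of \<open>S\<close> that is close to \<open>s\<close> lies below
  \<open>u\<close>, so \<open>s\<close> exceeds \<open>u\<close> by at most an arbitrarily small
  gauge power. Sharp suprema are thus least upper bounds, which is what makes them unique.\<close>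

lemma is_sharp_sup_le_gupper:
  assumes S: "S \<subseteq> carrier (gring \<rho>)" and s: "is_sharp_sup \<rho> S s" and u: "gupper \<rho> S u"
  shows "gle \<rho> s u"
proof -
  \<comment> \<open>All representatives of all elements of \<open>S\<close>: the closure criterion
    is phrased for images of sets of nets.\<close>
  let ?A = "{a \<in> moderate \<rho>. gcls \<rho> a \<in> S}"
  have A: "S = gcls \<rho> ` ?A"
  proof (intro equalityI subsetI)
    fix y assume "y \<in> S"
    with S obtain a where "a \<in> moderate \<rho>" "y = gcls \<rho> a" by (blast elim: gring_cases[OF \<rho>])
    with \<open>y \<in> S\<close> show "y \<in> gcls \<rho> ` ?A" by blast
  qed auto
  obtain s' where s': "s' \<in> moderate \<rho>" "s = gcls \<rho> s'"
    using s unfolding is_sharp_sup_def gupper_def by (blast elim: gring_cases[OF \<rho>])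
  obtain u' where u': "u' \<in> moderate \<rho>" "u = gcls \<rho> u'"
    using u unfolding gupper_def by (blast elim: gring_cases[OF \<rho>])
  have "gcls \<rho> s' \<in> Abstract_Topology.closure_of (sharp_topology \<rho>) (gcls \<rho> ` ?A)"
    using s A s' by (simp add: is_sharp_sup_def)
  then have cl: "\<forall>q. \<exists>a\<in>?A. \<forall>\<^sub>F \<epsilon> in at_bot. \<bar>a \<epsilon> - s' \<epsilon>\<bar> \<le> \<rho> \<epsilon> ^ q"
    by (subst (asm) gcls_in_sharp_closure_iff) (auto simp: s')
  have up: "\<forall>a\<in>?A. \<forall>n. \<forall>\<^sub>F \<epsilon> in at_bot. a \<epsilon> \<le> u' \<epsilon> + \<rho> \<epsilon> ^ n"
    using u A u' gupper_gcls_iff[of ?A u'] by auto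
  have "\<forall>\<^sub>F \<epsilon> in at_bot. s' \<epsilon> \<le> u' \<epsilon> + \<rho> \<epsilon> ^ n" for n
  proof -
    obtain a where a: "a \<in> ?A" "\<forall>\<^sub>F \<epsilon> in at_bot. \<bar>a \<epsilon> - s' \<epsilon>\<bar> \<le> \<rho> \<epsilon> ^ Suc n"
      using cl by blast
    then have "\<forall>\<^sub>F \<epsilon> in at_bot. a \<epsilon> \<le> u' \<epsilon> + \<rho> \<epsilon> ^ Suc n" using up by blast
    then show ?thesis
      using a(2) gauge_power_Suc_le_half[of n] by eventually_elim linarith
  qed
  then show ?thesis using s' u' by (simp add: gle_gcls_iff_power)
qed

lemma is_sharp_sup_unique:
  assumes "S \<subseteq> carrier (gring \<rho>)" "is_sharp_sup \<rho> S s" "is_sharp_sup \<rho> S t"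
  shows "s = t"
  using is_sharp_sup_le_gupper[OF assms(1,2), of t] is_sharp_sup_le_gupper[OF assms(1,3), of s] assms
  by (intro gle_antisym) (auto simp: is_sharp_sup_def gupper_def)

section \<open>The index set of hypernatural numbers\<close>

lemma hypernatE:
  assumes "n \<in> hypernat \<rho>"
  obtains k where "(\<lambda>\<epsilon>. real (k \<epsilon>)) \<in> moderate \<rho>" "n = gcls \<rho> (\<lambda>\<epsilon>. real (k \<epsilon>))"
proof -
  obtain x where x: "n = gcls \<rho> x" "x \<in> moderate \<rho>" "\<forall>\<epsilon>. x \<epsilon> \<in> \<nat>"
    using assms by (auto simp: hypernat_def)
  then have "\<forall>\<epsilon>. \<exists>k. x \<epsilon> = real k" by (metis Nats_cases)
  then obtain k where "\<forall>\<epsilon>. x \<epsilon> = real (k \<epsilon>)" by metis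
  then have "x = (\<lambda>\<epsilon>. real (k \<epsilon>))" by (simp add: fun_eq_iff)
  with x that show ?thesis by blast
qed

lemma gcls_real_in_hypernat:
  "(\<lambda>\<epsilon>. real (k \<epsilon>)) \<in> moderate \<rho> \<Longrightarrow> gcls \<rho> (\<lambda>\<epsilon>. real (k \<epsilon>)) \<in> hypernat \<rho>"
  by (auto simp: hypernat_def)

lemma hypernat_carrier: "n \<in> hypernat \<rho> \<Longrightarrow> n \<in> carrier (gring \<rho>)"
  by (auto simp: hypernat_def gcls_closed[OF \<rho>])

text \<open>Two hypernaturals need not be comparable, so going beyond both requires a common upper
  bound; the sum of natural-valued representatives is one.\<close>

lemma hypernat_directed:
  assumes "m \<in> hypernat \<rho>" "n \<in> hypernat \<rho>"
  shows "\<exists>p\<in>hypernat \<rho>. gle \<rho> m p \<and> gle \<rho> n p"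
proof -
  obtain j where j: "(\<lambda>\<epsilon>. real (j \<epsilon>)) \<in> moderate \<rho>" "m = gcls \<rho> (\<lambda>\<epsilon>. real (j \<epsilon>))"
    using assms(1) by (rule hypernatE)
  obtain k where k: "(\<lambda>\<epsilon>. real (k \<epsilon>)) \<in> moderate \<rho>" "n = gcls \<rho> (\<lambda>\<epsilon>. real (k \<epsilon>))"
    using assms(2) by (rule hypernatE)
  have p: "(\<lambda>\<epsilon>. real (j \<epsilon> + k \<epsilon>)) \<in> moderate \<rho>"
    using moderate_add[OF \<rho> j(1) k(1)] by simp
  have "gle \<rho> m (gcls \<rho> (\<lambda>\<epsilon>. real (j \<epsilon> + k \<epsilon>)))" "gle \<rho> n (gcls \<rho> (\<lambda>\<epsilon>. real (j \<epsilon> + k \<epsilon>)))"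
    unfolding j k by (intro gle_gcls_mono j k p; simp)+
  with gcls_real_in_hypernat[OF p] show ?thesis by blast
qed

text \<open>Moderateness puts every hypernatural below some
  \<open>inverse (\<rho> \<epsilon> ^ k)\<close>, and rounding these nets up makes them
  hypernaturals themselves. For a non-decreasing hypersequence, an upper bound of countably many
  terms is then enough.\<close>

lemma hypernat_countably_cofinal:
  "\<exists>c :: nat \<Rightarrow> _. range c \<subseteq> hypernat \<rho> \<and> (\<forall>n\<in>hypernat \<rho>. \<exists>k. gle \<rho> n (c k))"
proof -
  define b where "b k \<epsilon> = nat \<lceil>inverse (\<rho> \<epsilon> ^ k)\<rceil>" for k :: nat and \<epsilon>
  have inv: "1 \<le> inverse (\<rho> \<epsilon> ^ k)" for k \<epsilon>
    by (simp add: one_le_inverse gauge_bounds[OF \<rho>] power_le_one)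
  have b_ge: "inverse (\<rho> \<epsilon> ^ k) \<le> real (b k \<epsilon>)" for k \<epsilon>
    unfolding b_def by linarith
  have b_le: "real (b k \<epsilon>) \<le> inverse (\<rho> \<epsilon> ^ k) + 1" for k \<epsilon>
    using inv[where k = k and \<epsilon> = \<epsilon>] unfolding b_def by linarith
  have mod: "(\<lambda>\<epsilon>. real (b k \<epsilon>)) \<in> moderate \<rho>" for k
  proof (rule moderate_bound[OF \<rho> moderate_add[OF \<rho> _ moderate_const[OF \<rho>, of 1]]])
    show "(\<lambda>\<epsilon>. inverse (\<rho> \<epsilon> ^ k)) \<in> moderate \<rho>"
      unfolding moderate_def
      by (auto simp: gauge_bounds[OF \<rho>] intro!: exI[of _ k] always_eventually)
    show "\<forall>\<^sub>F \<epsilon> in at_bot. \<bar>real (b k \<epsilon>)\<bar> \<le> \<bar>inverse (\<rho> \<epsilon> ^ k) + 1\<bar>"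
      using b_le[of k] by (intro always_eventually) (smt (verit) of_nat_0_le_iff)
  qed
  have "\<exists>k. gle \<rho> n (gcls \<rho> (\<lambda>\<epsilon>. real (b k \<epsilon>)))" if n: "n \<in> hypernat \<rho>" for n
  proof -
    obtain j where j: "(\<lambda>\<epsilon>. real (j \<epsilon>)) \<in> moderate \<rho>" "n = gcls \<rho> (\<lambda>\<epsilon>. real (j \<epsilon>))"
      using n by (rule hypernatE)
    then obtain k where "\<forall>\<^sub>F \<epsilon> in at_bot. \<bar>real (j \<epsilon>)\<bar> \<le> inverse (\<rho> \<epsilon> ^ k)"
      by (auto simp: moderate_def)
    then have "\<forall>\<^sub>F \<epsilon> in at_bot. real (j \<epsilon>) \<le> real (b k \<epsilon>)"
    proof eventually_elim
      case (elim \<epsilon>)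
      then show ?case using b_ge[where k = k and \<epsilon> = \<epsilon>] by linarith
    qed
    then show ?thesis
      unfolding j using gle_gcls_mono[OF j(1) mod] by blast
  qed
  with gcls_real_in_hypernat[OF mod] show ?thesis
    by (intro exI[of _ "\<lambda>k. gcls \<rho> (\<lambda>\<epsilon>. real (b k \<epsilon>))"]) auto
qed

section \<open>Completeness from above along a countable sequence\<close>

lemma gcls_rep:
  assumes "X \<in> carrier (gring \<rho>)" "r \<in> X"
  shows "r \<in> moderate \<rho>" "X = gcls \<rho> r"
proof -
  obtain x where x: "x \<in> moderate \<rho>" "X = gcls \<rho> x" using assms(1) by (rule gring_cases[OF \<rho>])
  then show "r \<in> moderate \<rho>" "X = gcls \<rho> r"
    using assms(2) by (simp_all add: in_gcls_iff[OF \<rho>] gcls_eq_iff[OF \<rho>])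
qed

text \<open>
  The diagonal family takes, at \<open>\<epsilon>\<close>, the largest of the representatives of \<open>y j\<close> with
  \<open>j \<le> 1 / \<rho>\<^sub>\<epsilon>\<close>: finitely many for each \<open>\<epsilon>\<close>, but every \<open>j\<close> takes part for small \<open>\<epsilon>\<close>.
\<close>

lemma complete_from_above_sequence_bound:
  assumes S: "S \<subseteq> carrier (gring \<rho>)" and rc: "repr_choice \<rho> S ur sr"
    and complete: "complete_from_above \<rho> S ur sr"
    and U: "gupper \<rho> S U" and y: "range y \<subseteq> S"
  obtains t where "t \<in> carrier (gring \<rho>)"
    "t \<in> Abstract_Topology.closure_of (sharp_topology \<rho>) S" "\<And>k::nat. gle \<rho> (y k) t"
proof -
  \<comment> \<open>Condition (2) of completeness speaks about the representatives attached to this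
    particular net, so they are the ones used throughout.\<close>
  define R where "R = sr (upper_net \<rho> S ur sr)"
  have R: "R s \<in> moderate \<rho>" "s = gcls \<rho> (R s)" if "s \<in> S" for s
    using gcls_rep[of s "R s"] rc S that by (auto simp: R_def repr_choice_def)
  have yS: "y k \<in> S" for k using y by auto
  define J where "J \<epsilon> = {j::nat. real j * \<rho> \<epsilon> \<le> 1}" for \<epsilon>
  have fin: "finite (J \<epsilon>)" for \<epsilon>
  proof (rule finite_subset)
    show "J \<epsilon> \<subseteq> {..nat \<lceil>1 / \<rho> \<epsilon>\<rceil>}"
    proof
      fix j assume "j \<in> J \<epsilon>"
      then have "real j \<le> 1 / \<rho> \<epsilon>"
        using gauge_bounds(1)[OF \<rho>, of \<epsilon>] by (simp add: J_def field_simps)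
      then show "j \<in> {..nat \<lceil>1 / \<rho> \<epsilon>\<rceil>}" by simp linarith
    qed
  qed simp
  \<comment> \<open>\<open>J \<epsilon>\<close> is finite and contains 0, so the maximum over it is
    attained; \<open>d\<close> then selects an index whose value at \<open>\<epsilon>\<close>
    dominates all those in \<open>J \<epsilon>\<close>.\<close>
  have "\<exists>j. \<forall>k\<in>J \<epsilon>. R (y k) \<epsilon> \<le> R (y j) \<epsilon>" for \<epsilon>
  proof -
    have "0 \<in> J \<epsilon>" by (simp add: J_def)
    then have "Max ((\<lambda>k. R (y k) \<epsilon>) ` J \<epsilon>) \<in> (\<lambda>k. R (y k) \<epsilon>) ` J \<epsilon>"
      using fin by (intro Max_in) auto
    then obtain j where "Max ((\<lambda>k. R (y k) \<epsilon>) ` J \<epsilon>) = R (y j) \<epsilon>" by blast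
    then show ?thesis
      using fin Max_ge[of "(\<lambda>k. R (y k) \<epsilon>) ` J \<epsilon>"] by auto
  qed
  then obtain d where d: "\<And>\<epsilon> k. k \<in> J \<epsilon> \<Longrightarrow> R (y k) \<epsilon> \<le> R (y (d \<epsilon>)) \<epsilon>"
    by metis
  have J: "\<forall>\<^sub>F \<epsilon> in at_bot. k \<in> J \<epsilon>" for k
  proof -
    have "(\<rho> \<longlongrightarrow> 0) at_bot" using \<rho> by (simp add: gauge_net_def)
    then have "\<forall>\<^sub>F \<epsilon> in at_bot. \<rho> \<epsilon> < 1 / (real k + 1)" by (rule order_tendstoD) simp
    then show ?thesis
    proof eventually_elim
      case (elim \<epsilon>)
      then have "(real k + 1) * \<rho> \<epsilon> < 1" by (simp add: field_simps)
      then show ?case using gauge_bounds(1)[OF \<rho>, of \<epsilon>] by (simp add: J_def algebra_simps)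
    qed
  qed
  obtain u where u: "u \<in> moderate \<rho>" "U = gcls \<rho> u"
    using U unfolding gupper_def by (blast elim: gring_cases[OF \<rho>])
  \<comment> \<open>Exponent 0 in the order criterion allows an error of 1. The moderate net
    \<open>u + 1\<close> then serves all \<open>s\<close> at once, as the premise of condition (2)
    demands.\<close>
  have "\<forall>\<^sub>F \<epsilon> in at_bot. R s \<epsilon> \<le> u \<epsilon> + 1" if s: "s \<in> S" for s
  proof -
    have "gle \<rho> (gcls \<rho> (R s)) (gcls \<rho> u)"
      using U R(2)[OF s] s by (simp add: gupper_def flip: u(2))
    then have "\<forall>\<^sub>F \<epsilon> in at_bot. R s \<epsilon> \<le> u \<epsilon> + \<rho> \<epsilon> ^ 0"
      using gle_gcls_iff_power[OF R(1)[OF s] u(1)] by blast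
    then show ?thesis by simp
  qed
  then have bounded: "\<exists>u\<in>moderate \<rho>. \<forall>e. \<forall>\<^sub>F \<epsilon> in at_bot. R (y (d e)) \<epsilon> \<le> u \<epsilon>"
    using yS by (intro bexI[OF _ moderate_add[OF \<rho> u(1) moderate_const[OF \<rho>, of 1]]]) blast
  have diag: "\<forall>F. (\<forall>e. F e \<in> S) \<longrightarrow>
      (\<exists>u\<in>moderate \<rho>. \<forall>e. \<forall>\<^sub>F \<epsilon> in at_bot. R (F e) \<epsilon> \<le> u \<epsilon>) \<longrightarrow>
      (\<exists>t\<in>moderate \<rho>. gcls \<rho> t \<in> Abstract_Topology.closure_of (sharp_topology \<rho>) S \<and>
        (\<forall>\<^sub>F \<epsilon> in at_bot. R (F \<epsilon>) \<epsilon> \<le> t \<epsilon>))"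
    using complete unfolding complete_from_above_def R_def by (rule conjunct2)
  \<comment> \<open>On the diagonal \<open>e = \<epsilon>\<close> the family
    \<open>\<lambda>e. y (d e)\<close> dominates the value of every \<open>y k\<close> with
    \<open>k \<in> J \<epsilon>\<close>, so a net above the diagonal is eventually above each
    \<open>R (y k)\<close>.\<close>
  obtain t where t: "t \<in> moderate \<rho>"
    "gcls \<rho> t \<in> Abstract_Topology.closure_of (sharp_topology \<rho>) S"
    "\<forall>\<^sub>F \<epsilon> in at_bot. R (y (d \<epsilon>)) \<epsilon> \<le> t \<epsilon>"
    using diag[rule_format, of "\<lambda>e. y (d e)", OF yS bounded] by blast
  have "gle \<rho> (y k) (gcls \<rho> t)" for k
  proof -
    have "\<forall>\<^sub>F \<epsilon> in at_bot. R (y k) \<epsilon> \<le> t \<epsilon>"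
      using J[of k] t(3) by eventually_elim (use d in \<open>blast intro: order_trans\<close>)
    then have "gle \<rho> (gcls \<rho> (R (y k))) (gcls \<rho> t)"
      by (intro gle_gcls_mono R yS t)
    then show ?thesis using R(2)[OF yS[of k]] by simp
  qed
  with that t gcls_closed[OF \<rho>] show ?thesis by blast
qed

end

section \<open>Hyperlimits of non-decreasing hypersequences\<close>

text \<open>Terms near a hyperlimit put it in the closure, and monotonicity keeps all other terms
  below it. Conversely, one term near a sharp supremum squeezes all later ones between itself and
  the supremum. Fixing \<open>l\<close> lets this yield both the equivalence of existence and, with
  uniqueness, the equality.\<close>

lemma is_hyperlimit_iff_is_sharp_sup:
  assumes \<rho>: "gauge_net \<rho>" and \<sigma>: "gauge_net \<sigma>"
    and hyp: "hyperseq \<sigma> \<rho> x" and mono: "nondecreasing_hyperseq \<sigma> \<rho> x"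
  shows "is_hyperlimit \<sigma> \<rho> x l \<longleftrightarrow> is_sharp_sup \<rho> (x ` hypernat \<sigma>) l"
proof (cases "l \<in> carrier (gring \<rho>)")
  case False
  then show ?thesis by (simp add: is_hyperlimit_def is_sharp_sup_def gupper_def)
next
  case True
  then obtain l' where l': "l' \<in> moderate \<rho>" "l = gcls \<rho> l'" by (rule gring_cases[OF \<rho>])
  have "\<exists>r. r \<in> moderate \<rho> \<and> x n = gcls \<rho> r" if "n \<in> hypernat \<sigma>" for n
  proof -
    have "x n \<in> carrier (gring \<rho>)" using hyp that by (auto simp: hyperseq_def)
    then show ?thesis by (rule gring_cases[OF \<rho>]) blast
  qed
  then obtain r where r: "\<And>n. n \<in> hypernat \<sigma> \<Longrightarrow> r n \<in> moderate \<rho>"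
    "\<And>n. n \<in> hypernat \<sigma> \<Longrightarrow> x n = gcls \<rho> (r n)"
    by metis
  have img: "x ` hypernat \<sigma> = gcls \<rho> ` r ` hypernat \<sigma>"
    using r(2) by (force simp: image_iff)
  have rmod: "r ` hypernat \<sigma> \<subseteq> moderate \<rho>" using r(1) by blast
  have sup_iff: "is_sharp_sup \<rho> (x ` hypernat \<sigma>) l \<longleftrightarrow>
      (\<forall>n\<in>hypernat \<sigma>. \<forall>q. \<forall>\<^sub>F \<epsilon> in at_bot. r n \<epsilon> \<le> l' \<epsilon> + \<rho> \<epsilon> ^ q) \<and>
      (\<forall>q. \<exists>n\<in>hypernat \<sigma>. \<forall>\<^sub>F \<epsilon> in at_bot. \<bar>r n \<epsilon> - l' \<epsilon>\<bar> \<le> \<rho> \<epsilon> ^ q)"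
    unfolding is_sharp_sup_def img l'(2) gupper_gcls_iff[OF \<rho> rmod l'(1)]
      gcls_in_sharp_closure_iff[OF \<rho> rmod l'(1)] by blast
  have mono': "\<forall>\<^sub>F \<epsilon> in at_bot. r m \<epsilon> \<le> r n \<epsilon> + \<rho> \<epsilon> ^ q"
    if mn: "m \<in> hypernat \<sigma>" "n \<in> hypernat \<sigma>" "gle \<sigma> m n" for m n q
  proof -
    have "gle \<rho> (gcls \<rho> (r m)) (gcls \<rho> (r n))"
      using mono mn by (simp add: nondecreasing_hyperseq_def flip: r(2))
    then show ?thesis
      using gle_gcls_iff_power[OF \<rho> r(1)[OF mn(1)] r(1)[OF mn(2)]] by blast
  qed
  show ?thesis
  proof
    assume lim: "is_hyperlimit \<sigma> \<rho> x l"
    have close: "\<exists>M\<in>hypernat \<sigma>. \<forall>n\<in>hypernat \<sigma>. gle \<sigma> M n \<longrightarrow>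
        (\<forall>\<^sub>F \<epsilon> in at_bot. \<bar>r n \<epsilon> - l' \<epsilon>\<bar> \<le> \<rho> \<epsilon> ^ q)" for q
    proof -
      obtain M where M: "M \<in> hypernat \<sigma>" "\<And>n. n \<in> hypernat \<sigma> \<Longrightarrow> gle \<sigma> M n \<Longrightarrow>
          glt \<rho> (gabs \<rho> (x n \<ominus>\<^bsub>gring \<rho>\<^esub> l)) (gcls \<rho> \<rho> [^]\<^bsub>gring \<rho>\<^esub> q)"
        using lim unfolding is_hyperlimit_def by blast
      have "\<forall>\<^sub>F \<epsilon> in at_bot. \<bar>r n \<epsilon> - l' \<epsilon>\<bar> \<le> \<rho> \<epsilon> ^ q" if n: "n \<in> hypernat \<sigma>" "gle \<sigma> M n" for n
        using M(2)[OF n] unfolding r(2)[OF n(1)] l'(2)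
        by (rule glt_gabs_gcls_powerD[OF \<rho> r(1)[OF n(1)] l'(1)])
      with M(1) show ?thesis by blast
    qed
    show "is_sharp_sup \<rho> (x ` hypernat \<sigma>) l"
      unfolding sup_iff
    proof (intro conjI ballI allI)
      fix n q assume n: "n \<in> hypernat \<sigma>"
      obtain M where M: "M \<in> hypernat \<sigma>" "\<And>n. n \<in> hypernat \<sigma> \<Longrightarrow> gle \<sigma> M n \<Longrightarrow>
          \<forall>\<^sub>F \<epsilon> in at_bot. \<bar>r n \<epsilon> - l' \<epsilon>\<bar> \<le> \<rho> \<epsilon> ^ Suc q"
        using close[of "Suc q"] by blast
      \<comment> \<open>Closeness to \<open>l\<close> is known only beyond \<open>M\<close>, which
        may be incomparable with \<open>n\<close>; a common upper index \<open>p\<close> links the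
        two.\<close>
      obtain p where p: "p \<in> hypernat \<sigma>" "gle \<sigma> M p" "gle \<sigma> n p"
        using hypernat_directed[OF \<sigma> M(1) n] by blast
      show "\<forall>\<^sub>F \<epsilon> in at_bot. r n \<epsilon> \<le> l' \<epsilon> + \<rho> \<epsilon> ^ q"
        using M(2)[OF p(1,2)] mono'[OF n p(1,3), of "Suc q"] gauge_power_Suc_le_half[OF \<rho>, of q]
        by eventually_elim linarith
    next
      fix q
      show "\<exists>n\<in>hypernat \<sigma>. \<forall>\<^sub>F \<epsilon> in at_bot. \<bar>r n \<epsilon> - l' \<epsilon>\<bar> \<le> \<rho> \<epsilon> ^ q"
        using close[of q] gle_refl[OF \<sigma> hypernat_carrier[OF \<sigma>]] by blast
    qed
  next
    assume "is_sharp_sup \<rho> (x ` hypernat \<sigma>) l"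
    then have up: "\<And>n q. n \<in> hypernat \<sigma> \<Longrightarrow> \<forall>\<^sub>F \<epsilon> in at_bot. r n \<epsilon> \<le> l' \<epsilon> + \<rho> \<epsilon> ^ q"
      and cl: "\<And>q. \<exists>n\<in>hypernat \<sigma>. \<forall>\<^sub>F \<epsilon> in at_bot. \<bar>r n \<epsilon> - l' \<epsilon>\<bar> \<le> \<rho> \<epsilon> ^ q"
      unfolding sup_iff by blast+
    show "is_hyperlimit \<sigma> \<rho> x l"
      unfolding is_hyperlimit_def
    proof (intro conjI True allI)
      fix q :: nat
      \<comment> \<open>Of the two additional powers, one absorbs the sum of the closure error and
        the monotonicity error, the other makes the final inequality strict.\<close>
      obtain M where M: "M \<in> hypernat \<sigma>"
        "\<forall>\<^sub>F \<epsilon> in at_bot. \<bar>r M \<epsilon> - l' \<epsilon>\<bar> \<le> \<rho> \<epsilon> ^ Suc (Suc q)"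
        using cl by blast
      have "glt \<rho> (gabs \<rho> (x n \<ominus>\<^bsub>gring \<rho>\<^esub> l)) (gcls \<rho> \<rho> [^]\<^bsub>gring \<rho>\<^esub> q)"
        if n: "n \<in> hypernat \<sigma>" "gle \<sigma> M n" for n
        unfolding r(2)[OF n(1)] l'(2)
      proof (rule glt_gabs_gcls_powerI[OF \<rho> r(1)[OF n(1)] l'(1)])
        show "\<forall>\<^sub>F \<epsilon> in at_bot. \<bar>r n \<epsilon> - l' \<epsilon>\<bar> \<le> \<rho> \<epsilon> ^ Suc q"
          using M(2) mono'[OF M(1) n, of "Suc (Suc q)"] up[OF n(1), of "Suc q"]
            gauge_power_Suc_le_half[OF \<rho>, of "Suc q"]
          by eventually_elim linarith
      qed
      with M(1) show "\<exists>M\<in>hypernat \<sigma>. \<forall>n\<in>hypernat \<sigma>. gle \<sigma> M n \<longrightarrow>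
          glt \<rho> (gabs \<rho> (x n \<ominus>\<^bsub>gring \<rho>\<^esub> l)) (gcls \<rho> \<rho> [^]\<^bsub>gring \<rho>\<^esub> q)"
        by blast
    qed
  qed
qed

text \<open>The diagonal argument, run along a cofinal sequence of indices, yields a point of the
  closure above the selected terms. Monotonicity and transitivity extend the bound to all
  terms.\<close>

lemma complete_from_above_sharp_sup_exists:
  assumes \<rho>: "gauge_net \<rho>" and \<sigma>: "gauge_net \<sigma>"
    and hyp: "hyperseq \<sigma> \<rho> x" and mono: "nondecreasing_hyperseq \<sigma> \<rho> x"
    and rc: "repr_choice \<rho> (x ` hypernat \<sigma>) ur sr"
    and complete: "complete_from_above \<rho> (x ` hypernat \<sigma>) ur sr"
    and U: "gupper \<rho> (x ` hypernat \<sigma>) U"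
  shows "\<exists>s. is_sharp_sup \<rho> (x ` hypernat \<sigma>) s"
proof -
  have S: "x ` hypernat \<sigma> \<subseteq> carrier (gring \<rho>)"
    using hyp by (auto simp: hyperseq_def)
  obtain c :: "nat \<Rightarrow> _" where c: "\<And>k. c k \<in> hypernat \<sigma>"
    "\<And>n. n \<in> hypernat \<sigma> \<Longrightarrow> \<exists>k. gle \<sigma> n (c k)"
    using hypernat_countably_cofinal[OF \<sigma>] by blast
  have "range (\<lambda>k. x (c k)) \<subseteq> x ` hypernat \<sigma>" using c(1) by blast
  then obtain t where t: "t \<in> carrier (gring \<rho>)"
    "t \<in> Abstract_Topology.closure_of (sharp_topology \<rho>) (x ` hypernat \<sigma>)"
    "\<And>k. gle \<rho> (x (c k)) t"
    using complete_from_above_sequence_bound[OF \<rho> S rc complete U] by blast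
  have "gle \<rho> (x n) t" if n: "n \<in> hypernat \<sigma>" for n
  proof -
    obtain k where "gle \<sigma> n (c k)" using c(2)[OF n] by blast
    then have "gle \<rho> (x n) (x (c k))"
      using mono n c(1) by (auto simp: nondecreasing_hyperseq_def)
    then show ?thesis
      using S n c(1) by (intro gle_trans[OF \<rho> _ _ t(1) _ t(3)[of k]]) auto
  qed
  then show ?thesis
    using t by (auto simp: is_sharp_sup_def gupper_def)
qed

theorem theorem49:
  fixes \<rho> \<sigma> :: "idx \<Rightarrow> real"
    and x :: "(idx \<Rightarrow> real) set \<Rightarrow> (idx \<Rightarrow> real) set"
  assumes "gauge_net \<rho>" and "gauge_net \<sigma>"
    and "hyperseq \<sigma> \<rho> x" and "nondecreasing_hyperseq \<sigma> \<rho> x"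
  shows "((\<exists>l. is_hyperlimit \<sigma> \<rho> x l) \<longleftrightarrow> (\<exists>s. is_sharp_sup \<rho> (x ` hypernat \<sigma>) s))
    \<and> (\<forall>l s. is_hyperlimit \<sigma> \<rho> x l \<longrightarrow> is_sharp_sup \<rho> (x ` hypernat \<sigma>) s \<longrightarrow> l = s)
    \<and> (\<forall>ur sr. repr_choice \<rho> (x ` hypernat \<sigma>) ur sr \<longrightarrow>
         complete_from_above \<rho> (x ` hypernat \<sigma>) ur sr \<longrightarrow>
         ((\<exists>l. is_hyperlimit \<sigma> \<rho> x l) \<longleftrightarrow>
          (\<exists>U\<in>carrier (gring \<rho>). \<forall>n\<in>hypernat \<sigma>. gle \<rho> (x n) U)))"
proof -
  note lim_iff = is_hyperlimit_iff_is_sharp_sup[OF assms]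
  have S: "x ` hypernat \<sigma> \<subseteq> carrier (gring \<rho>)"
    using assms(3) by (auto simp: hyperseq_def)
  have upper: "(\<exists>U\<in>carrier (gring \<rho>). \<forall>n\<in>hypernat \<sigma>. gle \<rho> (x n) U) \<longleftrightarrow>
      (\<exists>U. gupper \<rho> (x ` hypernat \<sigma>) U)"
    by (auto simp: gupper_def)
  \<comment> \<open>With hyperlimits replaced by sharp suprema, the equality is uniqueness. In the
    boundedness criterion one direction is immediate, because a sharp supremum is itself an upper
    bound.\<close>
  show ?thesis
    unfolding lim_iff upper
    using is_sharp_sup_unique[OF assms(1) S] complete_from_above_sharp_sup_exists[OF assms]
    unfolding is_sharp_sup_def by blast
qed

end
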